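(* Minimum Matching Cut is polynomial-time solvable for claw-free graphs. That is, there is a polynomial-time algorithm that, given a claw-free graph $G$, determines the size of a minimum matching cut in $G$ (or reports that $G$ has no matching cut).
   Context: All graphs are finite, undirected, without multiple edges and self-loops. A set $M\subseteq E$ of edges of a graph $G=(V,E)$ is an edge cut if there is a partition $(R,B)$ of $V$ into two non-empty sets $R$ and $B$ such that $M$ consists of exactly those edges of $G$ with one end-vertex in $R$ and the other in $B$. An edge cut $M$ is a matching cut if $M$ is also a matching, i.e., no two edges of $M$ share an end-vertex. Not every graph has a matching cut. A matching cut is minimum if it has minimum size (number of edges) over all matching cuts of $G$. The problem Minimum Matching Cut takes as input a graph $G$ and asks for the size of a minimum matching cut in $G$. The claw is the star $K_{1,3}$; a graph is claw-free if it does not contain the claw as an induced subgraph. *)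

theory Defs
  imports "HOL-Computational_Algebra.Polynomial"
begin

section \<open>Graphs and matching cuts\<close>

datatype 'a graph = Graph (verts: "'a set") (edges: "'a set set")

definition simple_graph :: "'a graph \<Rightarrow> bool" where
  "simple_graph G \<longleftrightarrow>
     finite (verts G) \<and>
     edges G \<subseteq> {{u, v} | u v. u \<in> verts G \<and> v \<in> verts G \<and> u \<noteq> v}"

definition edge_cut :: "'a graph \<Rightarrow> 'a set set \<Rightarrow> bool" where
  "edge_cut G M \<longleftrightarrow>
     (\<exists>R B. R \<noteq> {} \<and> B \<noteq> {} \<and> R \<union> B = verts G \<and> R \<inter> B = {} \<and>
        M = {e \<in> edges G. \<exists>r\<in>R. \<exists>b\<in>B. e = {r, b}})"

definition matching :: "'a set set \<Rightarrow> bool" where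
  "matching M \<longleftrightarrow> (\<forall>e\<in>M. \<forall>f\<in>M. e \<noteq> f \<longrightarrow> e \<inter> f = {})"

definition matching_cut :: "'a graph \<Rightarrow> 'a set set \<Rightarrow> bool" where
  "matching_cut G M \<longleftrightarrow> edge_cut G M \<and> matching M"

definition minimum_matching_cut :: "'a graph \<Rightarrow> 'a set set \<Rightarrow> bool" where
  "minimum_matching_cut G M \<longleftrightarrow>
     matching_cut G M \<and> (\<forall>M'. matching_cut G M' \<longrightarrow> card M \<le> card M')"

definition contains_induced :: "'a graph \<Rightarrow> 'b graph \<Rightarrow> bool" where
  "contains_induced G H \<longleftrightarrow>
     (\<exists>f. inj_on f (verts H) \<and> f ` verts H \<subseteq> verts G \<and>
        (\<forall>u\<in>verts H. \<forall>v\<in>verts H. {f u, f v} \<in> edges G \<longleftrightarrow> {u, v} \<in> edges H))"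

definition claw :: "nat graph" where
  "claw = Graph {0, 1, 2, 3} {{0, 1}, {0, 2}, {0, 3}}"

definition claw_free :: "'a graph \<Rightarrow> bool" where
  "claw_free G \<longleftrightarrow> \<not> contains_induced G claw"

section \<open>Random access machines\<close>

text \<open>
  Algorithms are structured programs for a unit-cost random access machine over the natural
  numbers. A program uses finitely many named arrays of unbounded length; indices may be
  computed, and a scalar variable is an array that is only used at index 0. The only arithmetic
  operations are addition and truncated subtraction. In particular there is no multiplication,
  so from initial values of \<open>b\<close> bits only values of \<open>O(b + t)\<close> bits arise within \<open>t\<close> steps, and
  polynomial time on this machine is polynomial time on a Turing machine.
\<close>

type_synonym name = string
type_synonym state = "name \<Rightarrow> nat \<Rightarrow> nat"

datatype aexp =
    Const nat
  | Read name aexp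
  | Plus aexp aexp
  | Minus aexp aexp

datatype com =
    Skip
  | Write name aexp aexp
  | Seq com com
  | If aexp com com
  | While aexp com

fun aval :: "aexp \<Rightarrow> state \<Rightarrow> nat" where
  "aval (Const k) s = k"
| "aval (Read x a) s = s x (aval a s)"
| "aval (Plus a b) s = aval a s + aval b s"
| "aval (Minus a b) s = aval a s - aval b s"

fun acost :: "aexp \<Rightarrow> nat" where
  "acost (Const k) = 1"
| "acost (Read x a) = acost a + 1"
| "acost (Plus a b) = acost a + acost b + 1"
| "acost (Minus a b) = acost a + acost b + 1"

text \<open>
  \<open>exec c s t s'\<close>: started in state \<open>s\<close>, program \<open>c\<close> halts after \<open>t\<close> steps in state \<open>s'\<close>.
  Nonzero values count as true.
\<close>

inductive exec :: "com \<Rightarrow> state \<Rightarrow> nat \<Rightarrow> state \<Rightarrow> bool" where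
  Skip: "exec Skip s 1 s"
| Write: "exec (Write x a b) s (acost a + acost b + 1) (s(x := (s x)(aval a s := aval b s)))"
| Seq: "exec c s t s' \<Longrightarrow> exec d s' t' s'' \<Longrightarrow> exec (Seq c d) s (t + t') s''"
| IfTrue: "aval a s \<noteq> 0 \<Longrightarrow> exec c s t s' \<Longrightarrow> exec (If a c d) s (acost a + 1 + t) s'"
| IfFalse: "aval a s = 0 \<Longrightarrow> exec d s t s' \<Longrightarrow> exec (If a c d) s (acost a + 1 + t) s'"
| WhileFalse: "aval a s = 0 \<Longrightarrow> exec (While a c) s (acost a + 1) s"
| WhileTrue: "aval a s \<noteq> 0 \<Longrightarrow> exec c s t s' \<Longrightarrow> exec (While a c) s' t' s'' \<Longrightarrow>
    exec (While a c) s (acost a + 1 + t + t') s''"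

lemma exec_deterministic:
  "exec c s t s' \<Longrightarrow> exec c s u s'' \<Longrightarrow> u = t \<and> s'' = s'"
proof (induction arbitrary: u s'' rule: exec.induct)
  case (Skip s)
  then show ?case by (auto elim: exec.cases)
next
  case (Write x a b s)
  then show ?case by (auto elim: exec.cases)
next
  case (Seq c s t s' d t' s2)
  from Seq.prems show ?case
    by cases (use Seq.IH in blast)
next
  case (IfTrue a s c t s' d)
  from IfTrue.prems show ?case
    by cases (use IfTrue in blast)+
next
  case (IfFalse a s d t s' c)
  from IfFalse.prems show ?case
    by cases (use IfFalse in blast)+
next
  case (WhileFalse a s c)
  from WhileFalse.prems show ?case
    by cases (use WhileFalse in auto)
next
  case (WhileTrue a s c t s' t' s2)
  from WhileTrue.prems show ?case
    by cases (use WhileTrue in blast)+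
qed

section \<open>Polynomial-time solvability\<close>

definition initial_state :: "bool list \<Rightarrow> state" where
  "initial_state w = (\<lambda>x i.
     if x = ''in'' \<and> i < length w then of_bool (w ! i)
     else if x = ''len'' \<and> i = 0 then length w
     else 0)"

definition result :: "state \<Rightarrow> nat option" where
  "result s = (if s ''out'' 0 = 0 then None else Some (s ''out'' 1))"

text \<open>
  One program and one polynomial serve all instances in \<open>I\<close> and all words encoding them; the
  program may behave arbitrarily on words that encode no instance in \<open>I\<close>.
\<close>

definition poly_time_solvable ::
    "(bool list \<Rightarrow> 'i \<Rightarrow> bool) \<Rightarrow> 'i set \<Rightarrow> ('i \<Rightarrow> nat option \<Rightarrow> bool) \<Rightarrow> bool" where
  "poly_time_solvable encodes I solution \<longleftrightarrow>
     (\<exists>(c :: com) (p :: nat poly). \<forall>x\<in>I. \<forall>w. encodes w x \<longrightarrow>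
        (\<exists>t s. exec c (initial_state w) t s \<and> t \<le> poly p (length w) \<and> solution x (result s)))"

text \<open>The adjacency matrix of \<open>G\<close>, row by row, with respect to an arbitrary vertex ordering.\<close>

definition encodes_graph :: "bool list \<Rightarrow> 'a graph \<Rightarrow> bool" where
  "encodes_graph w G \<longleftrightarrow>
     (\<exists>vs. distinct vs \<and> set vs = verts G \<and>
        w = concat (map (\<lambda>u. map (\<lambda>v. {u, v} \<in> edges G) vs) vs))"

text \<open>\<open>None\<close> reports that there is no matching cut.\<close>

definition minimum_matching_cut_answer :: "'a graph \<Rightarrow> nat option \<Rightarrow> bool" where
  "minimum_matching_cut_answer G r \<longleftrightarrow>
     (case r of
        None \<Rightarrow> \<not> (\<exists>M. matching_cut G M)
      | Some k \<Rightarrow> \<exists>M. minimum_matching_cut G M \<and> card M = k)"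

end

theory Submission
  imports Defs
begin

text \<open>
  An edge in a triangle is never in a matching cut, and in a claw-free graph a vertex with two
  edges outside all triangles has no other edges. Give triangle edges a prohibitively large
  capacity and all other edges capacity 1, and consider a minimum cut between vertices \<open>a\<close>
  and \<open>b\<close>: if a vertex other than the terminals had two cut edges, then moving it to the other
  side would make the cut smaller. The terminals \<open>a\<close> and \<open>b\<close> are dealt with by guessing the
  only neighbours \<open>x\<close> and \<open>y\<close> to which they may have a cut edge. Thus the size of a minimum
  matching cut is the minimum over all \<open>(a, x, b, y)\<close> of these minimum cuts, as far as they are
  affordable. The cuts are computed by a push-relabel algorithm that pushes single units, so that
  there are no augmenting paths to search and all pushes are alike; at termination a gap in the
  heights shows the cut.
\<close>

section \<open>Weakest preconditions with a loop bound\<close>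

text \<open>Two edges \<open>c v\<close> and \<open>c v'\<close> outside all triangles exclude a
  third neighbour \<open>u\<close> of \<open>c\<close>: without a claw, two of \<open>v\<close>,
  \<open>v'\<close>, \<open>u\<close> would be adjacent, which puts at least one of the two edges
  into a triangle. The price \<open>n * n + 1\<close> exceeds the size of every edge cut, so a cut
  is affordable exactly if it avoids all forced edges. For a guess read off from a given matching
  cut, the minimum cut may be a different one; but it is no larger and is again a matching cut. So
  inequalities in both directions suffice, and the minimum over all guesses is exact. Pushing single
  units is polynomial only because the capacities are polynomially bounded as numbers: the supply
  \<open>D\<close> is of order \<open>n ^ 3\<close> and the initial potential of order
  \<open>n ^ 5\<close>. Steps are never counted individually: one common bound on the iterations of
  all loops determines a time bound through the structure of the program.\<close>

fun time_bound :: "nat \<Rightarrow> com \<Rightarrow> nat" where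
  "time_bound k Skip = 1"
| "time_bound k (Write x a b) = acost a + acost b + 1"
| "time_bound k (Seq c d) = time_bound k c + time_bound k d"
| "time_bound k (If a c d) = acost a + 1 + time_bound k c + time_bound k d"
| "time_bound k (While a c) = k * (acost a + 1 + time_bound k c) + (acost a + 1)"

text \<open>The degree is at most the nesting depth of the loops. As the program is fixed, a
  polynomial bound on the iterations \<open>k\<close> already gives polynomial time.\<close>

lemma time_bound_poly: "\<exists>p :: nat poly. \<forall>k. time_bound k c = poly p k"
proof (induction c)
  case Skip
  show ?case by (rule exI[of _ "[:1:]"]) simp
next
  case (Write x a b)
  show ?case by (rule exI[of _ "[:acost a + acost b + 1:]"]) simp
next
  case (Seq c d)
  then obtain p q where "\<forall>k. time_bound k c = poly p k" "\<forall>k. time_bound k d = poly q k"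
    by blast
  then show ?case by (intro exI[of _ "p + q"]) simp
next
  case (If a c d)
  then obtain p q where "\<forall>k. time_bound k c = poly p k" "\<forall>k. time_bound k d = poly q k"
    by blast
  then show ?case by (intro exI[of _ "[:acost a + 1:] + p + q"]) simp
next
  case (While a c)
  then obtain p where "\<forall>k. time_bound k c = poly p k"
    by blast
  then show ?case
    by (intro exI[of _ "[:0, 1:] * ([:acost a + 1:] + p) + [:acost a + 1:]"]) simp
qed

lemma poly_nat_mono: "x \<le> y \<Longrightarrow> poly p x \<le> poly p (y :: nat)"
  by (induction p) (auto intro: add_mono mult_mono)

fun writes :: "com \<Rightarrow> name set" where
  "writes Skip = {}"
| "writes (Write x a b) = {x}"
| "writes (Seq c d) = writes c \<union> writes d"
| "writes (If a c d) = writes c \<union> writes d"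
| "writes (While a c) = writes c"

lemma exec_frame: "exec c s t s' \<Longrightarrow> x \<notin> writes c \<Longrightarrow> s' x = s x"
  by (induction rule: exec.induct) auto

text \<open>The parameter \<open>k\<close> is meant to bound the number of iterations of each run of each loop.\<close>

definition wp :: "nat \<Rightarrow> com \<Rightarrow> (state \<Rightarrow> bool) \<Rightarrow> state \<Rightarrow> bool" where
  "wp k c Q s \<longleftrightarrow> (\<exists>t s'. exec c s t s' \<and> t \<le> time_bound k c \<and> Q s')"

lemma wp_Skip [simp]: "Q s \<Longrightarrow> wp k Skip Q s"
  unfolding wp_def using exec.Skip by fastforce

lemma wp_Write [simp]:
  "Q (s(x := (s x)(aval a s := aval b s))) \<Longrightarrow> wp k (Write x a b) Q s"
  unfolding wp_def using exec.Write by fastforce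

text \<open>Takes index and value in evaluated form, which keeps the state terms small along a
  sequence of writes.\<close>

lemma wp_Write_eq:
  assumes "aval a s = i" "aval b s = v" "Q (s(x := (s x)(i := v)))"
  shows "wp k (Write x a b) Q s"
  using assms by auto

lemma wp_Seq: "wp k c (wp k d Q) s \<Longrightarrow> wp k (Seq c d) Q s"
  unfolding wp_def by (fastforce intro: exec.Seq add_mono)

lemma wp_If:
  assumes "aval a s \<noteq> 0 \<Longrightarrow> wp k c Q s" "aval a s = 0 \<Longrightarrow> wp k d Q s"
  shows "wp k (If a c d) Q s"
proof (cases "aval a s = 0")
  case True
  then obtain t s' where "exec d s t s'" "t \<le> time_bound k d" "Q s'"
    using assms(2) unfolding wp_def by blast
  then show ?thesis
    unfolding wp_def using exec.IfFalse[OF True, of d t s' c] by fastforce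
next
  case False
  then obtain t s' where "exec c s t s'" "t \<le> time_bound k c" "Q s'"
    using assms(1) unfolding wp_def by blast
  then show ?thesis
    unfolding wp_def using exec.IfTrue[OF False, of c t s' d] by fastforce
qed

text \<open>Recovers all facts about untouched arrays, so that the specification of a program piece
  need only mention what it changes.\<close>

lemma wp_frame:
  assumes "wp k c R s" "\<And>s'. R s' \<Longrightarrow> (\<And>x. x \<notin> writes c \<Longrightarrow> s' x = s x) \<Longrightarrow> Q s'"
  shows "wp k c Q s"
  using assms unfolding wp_def by (meson exec_frame)

text \<open>\<open>I\<close> is invariant and variant in one: its index drops strictly in every
  iteration, so the initial index bounds their number.\<close>

lemma wp_While:
  assumes "I i s" "i \<le> k"
    and step: "\<And>i s. I i s \<Longrightarrow> aval a s \<noteq> 0 \<Longrightarrow> wp k c (\<lambda>s'. \<exists>j<i. I j s') s"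
    and exit: "\<And>i s. I i s \<Longrightarrow> aval a s = 0 \<Longrightarrow> Q s"
  shows "wp k (While a c) Q s"
proof -
  let ?b = "acost a + 1 + time_bound k c"
  \<comment> \<open>The induction needs the actual index as the number of iterations; it is relaxed
    to \<open>k\<close> only at the end.\<close>
  have "\<exists>t s'. exec (While a c) s t s' \<and> t \<le> i * ?b + (acost a + 1) \<and> Q s'"
    using \<open>I i s\<close>
  proof (induction i arbitrary: s rule: less_induct)
    case (less i)
    show ?case
    proof (cases "aval a s = 0")
      case True
      then show ?thesis
        using exec.WhileFalse[OF True, of c] exit[OF less.prems True] by fastforce
    next
      case False
      then obtain t s' j where 1: "exec c s t s'" "t \<le> time_bound k c" "j < i" "I j s'"
        using step[OF less.prems] unfolding wp_def by blast
      then obtain t' s'' where 2: "exec (While a c) s' t' s''" "t' \<le> j * ?b + (acost a + 1)" "Q s''"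
        using less.IH by blast
      have "Suc j * ?b \<le> i * ?b"
        using 1 by (intro mult_right_mono) auto
      then show ?thesis
        using exec.WhileTrue[OF False 1(1) 2(1)] 1(2) 2(2,3)
        by (intro exI[of _ "acost a + 1 + t + t'"] exI[of _ s'']) auto
    qed
  qed
  moreover have "i * ?b \<le> k * ?b"
    using \<open>i \<le> k\<close> by (rule mult_right_mono) simp
  ultimately show ?thesis
    unfolding wp_def by fastforce
qed

section \<open>Derived expressions, counting loops and linear search\<close>

abbreviation Var :: "name \<Rightarrow> aexp" where
  "Var x \<equiv> Read x (Const 0)"

abbreviation assign :: "name \<Rightarrow> aexp \<Rightarrow> com" where
  "assign x a \<equiv> Write x (Const 0) a"

definition Neg :: "aexp \<Rightarrow> aexp" where
  "Neg a = Minus (Const 1) a"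

definition And :: "aexp \<Rightarrow> aexp \<Rightarrow> aexp" where
  "And a b = Neg (Plus (Neg a) (Neg b))"

definition Eq :: "aexp \<Rightarrow> aexp \<Rightarrow> aexp" where
  "Eq a b = Neg (Plus (Minus a b) (Minus b a))"

lemma aval_Neg [simp]: "aval (Neg a) s = of_bool (aval a s = 0)"
  by (auto simp: Neg_def)

lemma aval_And [simp]: "aval (And a b) s = of_bool (aval a s \<noteq> 0 \<and> aval b s \<noteq> 0)"
  by (auto simp: And_def)

lemma aval_Eq [simp]: "aval (Eq a b) s = of_bool (aval a s = aval b s)"
  by (auto simp: Eq_def)

abbreviation update :: "state \<Rightarrow> name \<Rightarrow> nat \<Rightarrow> state" where
  "update s x v \<equiv> s(x := (s x)(0 := v))"

definition For :: "name \<Rightarrow> com \<Rightarrow> com" where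
  "For x c = Seq (assign x (Const 0))
     (While (Minus (Var ''n'') (Var x)) (Seq c (assign x (Plus (Var x) (Const 1)))))"

lemma writes_For [simp]: "writes (For x c) = insert x (writes c)"
  by (auto simp: For_def)

text \<open>The counter is advanced after the body, hence the step has to establish the invariant in
  the state where \<open>x\<close> already holds \<open>Suc i\<close>. The variant is
  \<open>n - i\<close>.\<close>

lemma wp_For:
  assumes n: "s ''n'' 0 = n" "n \<le> k" and x: "x \<noteq> ''n''" "x \<notin> writes c" "''n'' \<notin> writes c"
    and init: "I 0 (update s x 0)"
    and step: "\<And>i s'. i < n \<Longrightarrow> I i s' \<Longrightarrow> s' x 0 = i \<Longrightarrow>
      (\<And>y. y \<noteq> x \<Longrightarrow> y \<notin> writes c \<Longrightarrow> s' y = s y) \<Longrightarrow>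
      wp k c (\<lambda>s''. I (Suc i) (update s'' x (Suc i))) s'"
    and exit: "\<And>s'. I n s' \<Longrightarrow> (\<And>y. y \<noteq> x \<Longrightarrow> y \<notin> writes c \<Longrightarrow> s' y = s y) \<Longrightarrow> Q s'"
  shows "wp k (For x c) Q s"
proof -
  define J where "J = (\<lambda>j s'. \<exists>i\<le>n. j = n - i \<and> s' x 0 = i \<and> I i s' \<and>
    (\<forall>y. y \<noteq> x \<longrightarrow> y \<notin> writes c \<longrightarrow> s' y = s y))"
  show ?thesis
    unfolding For_def
  proof (intro wp_Seq wp_Write, rule wp_While[where I = J and i = n])
    show "J n (s(x := (s x)(aval (Const 0) s := aval (Const 0) s)))"
      using init unfolding J_def by (intro exI[of _ 0]) auto
    show "n \<le> k" by fact
  next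
    fix j s'
    assume J: "J j s'" and a: "aval (Minus (Var ''n'') (Var x)) s' \<noteq> 0"
    then obtain i where i: "i \<le> n" "j = n - i" "s' x 0 = i" "I i s'"
      and fr: "\<And>y. y \<noteq> x \<Longrightarrow> y \<notin> writes c \<Longrightarrow> s' y = s y"
      unfolding J_def by blast
    have "i < n"
      using a i(3) fr[of "''n''"] x n by simp
    show "wp k (Seq c (assign x (Plus (Var x) (Const 1)))) (\<lambda>s'. \<exists>j'<j. J j' s') s'"
    proof (rule wp_Seq, rule wp_frame[OF step[OF \<open>i < n\<close> i(4,3) fr]])
      fix s2
      assume "I (Suc i) (update s2 x (Suc i))"
        and fr2: "\<And>y. y \<notin> writes c \<Longrightarrow> s2 y = s' y"
      moreover have "s2 x 0 = i"
        using fr2 x i by simp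
      ultimately show "wp k (assign x (Plus (Var x) (Const 1))) (\<lambda>s'. \<exists>j'<j. J j' s') s2"
        using fr i \<open>i < n\<close> x by (intro wp_Write exI[of _ "n - Suc i"]) (auto simp: J_def)
    qed
  next
    fix j s'
    assume J: "J j s'" and a: "aval (Minus (Var ''n'') (Var x)) s' = 0"
    then obtain i where i: "i \<le> n" "j = n - i" "s' x 0 = i" "I i s'"
      and fr: "\<And>y. y \<noteq> x \<Longrightarrow> y \<notin> writes c \<Longrightarrow> s' y = s y"
      unfolding J_def by blast
    have "i = n"
      using a i fr[of "''n''"] x n by simp
    then show "Q s'"
      using exit i fr by blast
  qed
qed

text \<open>\<open>z\<close> doubles as a flag: the value \<open>n\<close>, which is no index, means
  that nothing was found. Otherwise the last hit remains, but \<open>wp_Find\<close> only promises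
  some hit.\<close>

definition Find :: "name \<Rightarrow> name \<Rightarrow> aexp \<Rightarrow> com" where
  "Find z v a = Seq (assign z (Var ''n'')) (For v (If a (assign z (Var v)) Skip))"

lemma writes_Find [simp]: "writes (Find z v a) = {z, v}"
  by (auto simp: Find_def)

lemma wp_Find:
  assumes n: "s ''n'' 0 = n" "n \<le> k" and names: "v \<noteq> ''n''" "z \<noteq> ''n''" "v \<noteq> z"
    and a: "\<And>i s'. i < n \<Longrightarrow> s' v 0 = i \<Longrightarrow> (\<And>y. y \<noteq> v \<Longrightarrow> y \<noteq> z \<Longrightarrow> s' y = s y) \<Longrightarrow>
      aval a s' \<noteq> 0 \<longleftrightarrow> P i"
    and exit: "\<And>s'. (\<And>y. y \<noteq> v \<Longrightarrow> y \<noteq> z \<Longrightarrow> s' y = s y) \<Longrightarrow>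
      (s' z 0 = n \<and> (\<forall>i<n. \<not> P i)) \<or> (s' z 0 < n \<and> P (s' z 0)) \<Longrightarrow> Q s'"
  shows "wp k (Find z v a) Q s"
  unfolding Find_def
proof (intro wp_Seq wp_Write, rule wp_For[where n = n and
    I = "\<lambda>i s'. (s' z 0 = n \<and> (\<forall>j<i. \<not> P j)) \<or> (s' z 0 < n \<and> P (s' z 0))"])
  fix i s'
  assume i: "i < n" "s' v 0 = i"
    and I: "(s' z 0 = n \<and> (\<forall>j<i. \<not> P j)) \<or> (s' z 0 < n \<and> P (s' z 0))"
    and fr: "\<And>y. y \<noteq> v \<Longrightarrow> y \<notin> writes (If a (assign z (Var v)) Skip) \<Longrightarrow>
      s' y = (s(z := (s z)(aval (Const 0) s := aval (Var ''n'') s))) y"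
  have "aval a s' \<noteq> 0 \<longleftrightarrow> P i"
    using i fr by (intro a) auto
  then show "wp k (If a (assign z (Var v)) Skip)
      (\<lambda>s''. (update s'' v (Suc i) z 0 = n \<and> (\<forall>j<Suc i. \<not> P j)) \<or>
        (update s'' v (Suc i) z 0 < n \<and> P (update s'' v (Suc i) z 0))) s'"
    using I i names by (intro wp_If wp_Write wp_Skip) (auto simp: less_Suc_eq)
qed (use assms in auto)

section \<open>Minimum cuts by unit push-relabel\<close>

definition cut_capacity :: "nat \<Rightarrow> (nat \<Rightarrow> nat \<Rightarrow> nat) \<Rightarrow> nat set \<Rightarrow> nat" where
  "cut_capacity n cap S = (\<Sum>u\<in>S. \<Sum>v\<in>{..<n} - S. cap u v)"

definition min_cut :: "nat \<Rightarrow> (nat \<Rightarrow> nat \<Rightarrow> nat) \<Rightarrow> nat \<Rightarrow> nat \<Rightarrow> nat \<Rightarrow> bool" where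
  "min_cut n cap s t m \<longleftrightarrow>
     (\<exists>S\<subseteq>{..<n}. s \<in> S \<and> t \<notin> S \<and> cut_capacity n cap S = m) \<and>
     (\<forall>S\<subseteq>{..<n}. s \<in> S \<longrightarrow> t \<notin> S \<longrightarrow> m \<le> cut_capacity n cap S)"

text \<open>
  Instead of saturating the arcs at the source, the source starts at height 0 with an excess
  \<open>D\<close> that its arcs cannot carry away, so that it stays active and is eventually lifted to
  height \<open>n\<close> like any other active vertex. Here \<open>r\<close> are residual capacities, \<open>e\<close> excesses and
  \<open>h\<close> heights; the flow from \<open>u\<close> to \<open>v\<close> is \<open>cap u v - r u v\<close>.
\<close>

locale network =
  fixes n :: nat and cap :: "nat \<Rightarrow> nat \<Rightarrow> nat" and s t D :: nat
  assumes cap_sym: "cap u v = cap v u"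
    and s: "s < n" and t: "t < n" and s_neq_t: "s \<noteq> t"
    and D: "(\<Sum>u<n. cap s u) < D"
begin

text \<open>Antisymmetry of the flow turns into \<open>r u v + r v u = 2 * cap u v\<close> because
  \<open>cap\<close> is symmetric. The second conjunct says that the excess is supply plus net
  inflow, rearranged so that no subtraction occurs in \<open>nat\<close>.\<close>

definition preflow :: "(nat \<Rightarrow> nat \<Rightarrow> nat) \<Rightarrow> (nat \<Rightarrow> nat) \<Rightarrow> (nat \<Rightarrow> nat) \<Rightarrow> bool" where
  "preflow r e h \<longleftrightarrow>
     (\<forall>u<n. \<forall>v<n. r u v + r v u = 2 * cap u v) \<and>
     (\<forall>v<n. e v + (\<Sum>u<n. r u v) = (if v = s then D else 0) + (\<Sum>u<n. cap u v)) \<and>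
     (\<forall>u<n. \<forall>v<n. 0 < r u v \<longrightarrow> h u \<le> h v + 1) \<and>
     h t = 0 \<and> (\<forall>v<n. h v \<le> n)"

text \<open>Relabelling lowers the first sum by 1 and raises the second by the excess of the vertex,
  which is at most \<open>D\<close>; hence the factor \<open>D + 1\<close>. A push carries one unit
  down one level and lowers the second sum by 1.\<close>

definition potential :: "(nat \<Rightarrow> nat) \<Rightarrow> (nat \<Rightarrow> nat) \<Rightarrow> nat" where
  "potential e h = (D + 1) * (\<Sum>v<n. n - h v) + (\<Sum>v<n. e v * h v)"

lemma preflow_init:
  assumes "\<And>u v. u < n \<Longrightarrow> v < n \<Longrightarrow> r u v = cap u v"
    and "\<And>v. v < n \<Longrightarrow> e v = (if v = s then D else 0)" "\<And>v. v < n \<Longrightarrow> h v = 0"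
  shows "preflow r e h" "potential e h = (D + 1) * (n * n)"
  using assms s t by (auto simp: preflow_def potential_def cap_sym)

text \<open>Adding the double sum to its transpose pairs \<open>r u v\<close> with
  \<open>r v u\<close>: flow inside a set cancels.\<close>

lemma sum_symmetric_cancel:
  assumes "\<And>u v. u \<in> T \<Longrightarrow> v \<in> T \<Longrightarrow> r u v + r v u = 2 * (cap u v :: nat)"
  shows "(\<Sum>v\<in>T. \<Sum>u\<in>T. r u v) = (\<Sum>v\<in>T. \<Sum>u\<in>T. cap u v)"
proof -
  have "2 * (\<Sum>v\<in>T. \<Sum>u\<in>T. r u v) = (\<Sum>v\<in>T. \<Sum>u\<in>T. r u v) + (\<Sum>v\<in>T. \<Sum>u\<in>T. r v u)"
    using sum.swap[of r T T] by simp
  also have "\<dots> = (\<Sum>v\<in>T. \<Sum>u\<in>T. 2 * cap u v)"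
    unfolding sum.distrib[symmetric] using assms by (intro sum.cong) auto
  also have "\<dots> = 2 * (\<Sum>v\<in>T. \<Sum>u\<in>T. cap u v)"
    by (simp add: sum_distrib_left)
  finally show ?thesis by simp
qed

text \<open>Sum the balances outside \<open>S\<close>; arcs with both ends there cancel. For
  \<open>s \<in> S\<close> this yields weak duality, and equality of excess and capacity once no
  residual arc leaves \<open>S\<close>.\<close>

lemma excess_of_set:
  assumes "preflow r e h" "S \<subseteq> {..<n}"
  shows "(\<Sum>v\<in>{..<n} - S. e v) + (\<Sum>v\<in>{..<n} - S. \<Sum>u\<in>S. r u v) =
    (if s \<in> S then 0 else D) + cut_capacity n cap S"
proof -
  let ?T = "{..<n} - S"
  have split: "(\<Sum>u<n. f u) = (\<Sum>u\<in>S. f u) + (\<Sum>u\<in>?T. f u)" for f :: "nat \<Rightarrow> nat"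
    using sum.subset_diff[of S "{..<n}" f] assms(2) by simp
  have "(\<Sum>v\<in>?T. e v) + (\<Sum>v\<in>?T. \<Sum>u<n. r u v) = (\<Sum>v\<in>?T. e v + (\<Sum>u<n. r u v))"
    by (simp add: sum.distrib)
  also have "\<dots> = (\<Sum>v\<in>?T. (if v = s then D else 0) + (\<Sum>u<n. cap u v))"
    using assms(1) unfolding preflow_def by (intro sum.cong) auto
  also have "\<dots> = (if s \<in> S then 0 else D) + (\<Sum>v\<in>?T. \<Sum>u<n. cap u v)"
    using s by (simp add: sum.distrib sum.delta)
  finally have "(\<Sum>v\<in>?T. e v) + (\<Sum>v\<in>?T. \<Sum>u\<in>S. r u v) + (\<Sum>v\<in>?T. \<Sum>u\<in>?T. r u v) =
    (if s \<in> S then 0 else D) + (\<Sum>v\<in>?T. \<Sum>u\<in>S. cap u v) + (\<Sum>v\<in>?T. \<Sum>u\<in>?T. cap u v)"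
    by (simp add: split sum.distrib)
  moreover have "(\<Sum>v\<in>?T. \<Sum>u\<in>?T. r u v) = (\<Sum>v\<in>?T. \<Sum>u\<in>?T. cap u v)"
    using assms(1) unfolding preflow_def by (intro sum_symmetric_cancel) auto
  moreover have "(\<Sum>v\<in>?T. \<Sum>u\<in>S. cap u v) = cut_capacity n cap S"
    unfolding cut_capacity_def by (rule sum.swap)
  ultimately show ?thesis by simp
qed

lemma excess_total: "preflow r e h \<Longrightarrow> (\<Sum>v<n. e v) = D"
  using excess_of_set[of r e h "{}"] by (simp add: cut_capacity_def)

text \<open>Each \<open>r u s\<close> is at most \<open>2 * cap u s\<close>, so the net outflow of
  the source stays below \<open>D\<close>.\<close>

lemma source_active:
  assumes "preflow r e h"
  shows "0 < e s"
proof -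
  have "(\<Sum>u<n. r u s) \<le> (\<Sum>u<n. cap u s + cap s u)"
    using assms s cap_sym unfolding preflow_def
    by (intro sum_mono) (metis le_add1 lessThan_iff mult_2)
  also have "\<dots> < (\<Sum>u<n. cap u s) + D"
    using D by (simp add: sum.distrib)
  finally show ?thesis
    using assms s unfolding preflow_def by (metis add.commute add_0 less_irrefl gr0I)
qed

text \<open>The active source must have reached height \<open>n\<close>, and the sink has height 0.
  The other \<open>n - 2\<close> vertices cannot occupy all \<open>n - 1\<close> heights strictly
  between, so some height \<open>k\<close> is empty. Residual arcs descend by at most one level,
  hence none crosses this gap. Below it only \<open>t\<close> can hold excess, so everything that
  crossed the cut is at \<open>t\<close>.\<close>

lemma min_cut_of_final_preflow:
  assumes pre: "preflow r e h"
    and final: "\<And>u. u < n \<Longrightarrow> u \<noteq> t \<Longrightarrow> 0 < e u \<Longrightarrow> n \<le> h u"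
  shows "min_cut n cap s t (e t)"
proof -
  have hs: "h s = n"
    using pre final[OF s s_neq_t source_active[OF pre]] s unfolding preflow_def
    by (simp add: le_antisym)
  have ht: "h t = 0"
    using pre unfolding preflow_def by blast
  have "card (h ` ({..<n} - {s, t})) \<le> card ({..<n} - {s, t})"
    by (rule card_image_le) simp
  also have "\<dots> = n - 2"
    using s t s_neq_t by (subst card_Diff_subset) auto
  also have "\<dots> < card {1..<n}"
    using s t s_neq_t by simp
  finally have "\<not> {1..<n} \<subseteq> h ` ({..<n} - {s, t})"
    by (meson card_mono finite_Diff finite_imageI finite_lessThan leD)
  then obtain k where "k \<in> {1..<n}" and k: "k \<notin> h ` ({..<n} - {s, t})"
    by blast
  then have k: "1 \<le> k" "k < n" "k \<notin> h ` ({..<n} - {s, t})"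
    by simp_all
  then have gap: "h u \<noteq> k" if "u < n" for u
    using that hs ht by auto
  define S where "S = {u. u < n \<and> k < h u}"
  have S: "S \<subseteq> {..<n}" "s \<in> S" "t \<notin> S"
    using hs ht s k by (auto simp: S_def)
  have "r u v = 0" if "u \<in> S" "v \<in> {..<n} - S" for u v
  proof (rule ccontr)
    assume "r u v \<noteq> 0"
    then have "h u \<le> h v + 1"
      using pre that unfolding preflow_def S_def by auto
    then show False
      using that gap[of v] unfolding S_def by auto
  qed
  then have "(\<Sum>v\<in>{..<n} - S. e v) = cut_capacity n cap S"
    using excess_of_set[OF pre S(1)] S(2) by simp
  moreover have "e v = 0" if "v \<in> {..<n} - S - {t}" for v
    using that final[of v] k unfolding S_def by force
  then have "(\<Sum>v\<in>{..<n} - S. e v) = e t"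
    using S(3) t by (subst sum.remove[of _ t]) auto
  ultimately have "cut_capacity n cap S = e t"
    by simp
  \<comment> \<open>Weak duality: whatever has arrived at \<open>t\<close> had to cross every
    cut.\<close>
  moreover have "e t \<le> cut_capacity n cap S'" if "S' \<subseteq> {..<n}" "s \<in> S'" "t \<notin> S'" for S'
  proof -
    have "e t \<le> (\<Sum>v\<in>{..<n} - S'. e v)"
      using that t by (intro member_le_sum) auto
    then show ?thesis
      using excess_of_set[OF pre that(1)] that(2) by simp
  qed
  ultimately show ?thesis
    unfolding min_cut_def using S by blast
qed

lemma sum_shift_unit:
  fixes e e' h :: "nat \<Rightarrow> nat"
  assumes "finite A" "u \<in> A" "w \<in> A" "u \<noteq> w" "e u = Suc (e' u)" "e' w = Suc (e w)"
    and "\<And>v. v \<in> A \<Longrightarrow> v \<noteq> u \<Longrightarrow> v \<noteq> w \<Longrightarrow> e' v = e v"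
  shows "(\<Sum>v\<in>A. e' v * h v) + h u = (\<Sum>v\<in>A. e v * h v) + h w"
proof -
  have "(\<Sum>v\<in>A - {u, w}. e' v * h v) = (\<Sum>v\<in>A - {u, w}. e v * h v)"
    using assms by (intro sum.cong) auto
  moreover have "(\<Sum>v\<in>A. f v) = f u + (f w + (\<Sum>v\<in>A - {u, w}. f v))" for f :: "nat \<Rightarrow> nat"
    using assms by (simp add: sum.remove[of A u] sum.remove[of "A - {u}" w] Diff_insert2[symmetric]
        insert_commute)
  ultimately show ?thesis
    using assms by simp
qed

text \<open>The only arc that may become residual leads uphill from \<open>w\<close> to
  \<open>u\<close>, so the height condition survives. In the balances, the moved unit of excess is
  offset by the changed residual capacities into \<open>u\<close> and \<open>w\<close>.\<close>

lemma push:
  assumes pre: "preflow r e h" and u: "u < n" and w: "w < n"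
    and adm: "0 < e u" "0 < r u w" "h u = h w + 1"
    and r': "r' u w = r u w - 1" "r' w u = r w u + 1"
      "\<And>i j. i < n \<Longrightarrow> j < n \<Longrightarrow> (i, j) \<noteq> (u, w) \<Longrightarrow> (i, j) \<noteq> (w, u) \<Longrightarrow> r' i j = r i j"
    and e': "e' u = e u - 1" "e' w = e w + 1" "\<And>i. i < n \<Longrightarrow> i \<noteq> u \<Longrightarrow> i \<noteq> w \<Longrightarrow> e' i = e i"
  shows "preflow r' e' h" "potential e' h < potential e h"
proof -
  have uw: "u \<noteq> w"
    using adm by auto
  have "(\<Sum>i<n. r' i v) = (\<Sum>i<n. r i v)" if "v < n" "v \<noteq> u" "v \<noteq> w" for v
    using that r'(3) by (intro sum.cong) auto
  moreover have "(\<Sum>i<n. r' i w) + 1 = (\<Sum>i<n. r i w)"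
  proof -
    have "(\<Sum>i\<in>{..<n} - {u}. r' i w) = (\<Sum>i\<in>{..<n} - {u}. r i w)"
      using uw w r'(3) by (intro sum.cong) auto
    then show ?thesis
      using u adm r'(1) by (simp add: sum.remove[of "{..<n}" u])
  qed
  moreover have "(\<Sum>i<n. r' i u) = (\<Sum>i<n. r i u) + 1"
  proof -
    have "(\<Sum>i\<in>{..<n} - {w}. r' i u) = (\<Sum>i\<in>{..<n} - {w}. r i u)"
      using uw u r'(3) by (intro sum.cong) auto
    then show ?thesis
      using w r'(2) by (simp add: sum.remove[of "{..<n}" w])
  qed
  ultimately have "e' v + (\<Sum>i<n. r' i v) = e v + (\<Sum>i<n. r i v)" if "v < n" for v
    using that adm e' by (cases "v = u"; cases "v = w") auto
  moreover have "r' i j + r' j i = 2 * cap i j" if "i < n" "j < n" for i j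
  proof -
    have sum: "r i j + r j i = 2 * cap i j"
      using pre that unfolding preflow_def by blast
    consider "i = u \<and> j = w" | "i = w \<and> j = u"
      | "(i, j) \<noteq> (u, w)" "(i, j) \<noteq> (w, u)" "(j, i) \<noteq> (u, w)" "(j, i) \<noteq> (w, u)"
      by auto
    then show ?thesis
      using that r' adm(2) sum by cases simp_all
  qed
  moreover have "h i \<le> h j + 1" if "i < n" "j < n" "0 < r' i j" for i j
  proof (cases "(i, j) = (w, u)")
    case True
    then show ?thesis using adm by simp
  next
    case False
    then have "0 < r i j"
      using that r' adm by (cases "(i, j) = (u, w)") auto
    then show ?thesis
      using pre that unfolding preflow_def by blast
  qed
  ultimately show "preflow r' e' h"
    using pre unfolding preflow_def by simp
  have "(\<Sum>v<n. e' v * h v) + h u = (\<Sum>v<n. e v * h v) + h w"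
    using u w uw adm e' by (intro sum_shift_unit) auto
  then show "potential e' h < potential e h"
    using adm unfolding potential_def by simp
qed

text \<open>Residual arcs leaving \<open>u\<close> satisfy \<open>h u \<le> h w + 1\<close>, and
  \<open>no_adm\<close> excludes equality; this leaves room for exactly the one level by which
  \<open>u\<close> is lifted.\<close>

lemma relabel:
  assumes pre: "preflow r e h" and u: "u < n" "u \<noteq> t" "0 < e u" "h u < n"
    and no_adm: "\<And>w. w < n \<Longrightarrow> \<not> (0 < r u w \<and> h u = h w + 1)"
    and h': "h' u = h u + 1" "\<And>v. v < n \<Longrightarrow> v \<noteq> u \<Longrightarrow> h' v = h v"
  shows "preflow r e h'" "potential e h' < potential e h"
proof -
  have "h' i \<le> h' j + 1" if "i < n" "j < n" "0 < r i j" for i j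
  proof -
    have "h i \<le> h j + 1"
      using pre that unfolding preflow_def by blast
    then show ?thesis
      using that no_adm[of j] h' by (cases "i = u"; cases "j = u") fastforce+
  qed
  then show "preflow r e h'"
    using pre u t h' unfolding preflow_def by (metis Suc_eq_plus1 Suc_leI)
  have "e u \<le> D"
    using excess_total[OF pre] u member_le_sum[of u "{..<n}" e] by simp
  moreover have "(\<Sum>v<n. n - h' v) + 1 = (\<Sum>v<n. n - h v)"
  proof -
    have "(\<Sum>v\<in>{..<n} - {u}. n - h' v) = (\<Sum>v\<in>{..<n} - {u}. n - h v)"
      using h' by (intro sum.cong) auto
    then show ?thesis
      using u h' by (simp add: sum.remove[of "{..<n}" u])
  qed
  moreover have "(\<Sum>v<n. e v * h' v) = (\<Sum>v<n. e v * h v) + e u"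
  proof -
    have "(\<Sum>v\<in>{..<n} - {u}. e v * h' v) = (\<Sum>v\<in>{..<n} - {u}. e v * h v)"
      using h' by (intro sum.cong) auto
    then show ?thesis
      using u h' by (simp add: sum.remove[of "{..<n}" u])
  qed
  ultimately show "potential e h' < potential e h"
    unfolding potential_def by (simp flip: \<open>_ + 1 = _\<close>)
qed

end

section \<open>Matching cuts as minimum cuts\<close>

text \<open>Cut edges are oriented from \<open>S\<close> to its complement. Two of them can then
  share an end-vertex only in the same component, and each edge is counted once.\<close>

definition crossing :: "nat \<Rightarrow> (nat \<Rightarrow> nat \<Rightarrow> bool) \<Rightarrow> nat set \<Rightarrow> (nat \<times> nat) set" where
  "crossing n adj S = {(u, v). u \<in> S \<and> v \<in> {..<n} - S \<and> adj u v}"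

definition matching_side :: "nat \<Rightarrow> (nat \<Rightarrow> nat \<Rightarrow> bool) \<Rightarrow> nat set \<Rightarrow> bool" where
  "matching_side n adj S \<longleftrightarrow> S \<subseteq> {..<n} \<and> S \<noteq> {} \<and> S \<noteq> {..<n} \<and>
     (\<forall>e\<in>crossing n adj S. \<forall>f\<in>crossing n adj S. e \<noteq> f \<longrightarrow> fst e \<noteq> fst f \<and> snd e \<noteq> snd f)"

text \<open>
  An edge of a triangle never belongs to a matching cut. The extra forced edges at the terminals
  \<open>a\<close> and \<open>b\<close>, all but those to \<open>x\<close> and \<open>y\<close>, keep the terminals from having two cut edges.
\<close>

definition forced :: "nat \<Rightarrow> (nat \<Rightarrow> nat \<Rightarrow> bool) \<Rightarrow> nat \<Rightarrow> nat \<Rightarrow> nat \<Rightarrow> nat \<Rightarrow> nat \<Rightarrow> nat \<Rightarrow> bool" where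
  "forced n adj a x b y u v \<longleftrightarrow> (\<exists>w<n. adj u w \<and> adj v w) \<or>
     u = a \<and> v \<noteq> x \<or> v = a \<and> u \<noteq> x \<or> u = b \<and> v \<noteq> y \<or> v = b \<and> u \<noteq> y"

definition capacity :: "nat \<Rightarrow> (nat \<Rightarrow> nat \<Rightarrow> bool) \<Rightarrow> nat \<Rightarrow> nat \<Rightarrow> nat \<Rightarrow> nat \<Rightarrow> nat \<Rightarrow> nat \<Rightarrow> nat" where
  "capacity n adj a x b y u v =
     (if adj u v then if forced n adj a x b y u v then n * n + 1 else 1 else 0)"

locale claw_free_adjacency =
  fixes n :: nat and adj :: "nat \<Rightarrow> nat \<Rightarrow> bool"
  assumes adj_sym: "adj u v \<Longrightarrow> adj v u"
    and adj_irrefl: "\<not> adj u u"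
    and adj_less: "adj u v \<Longrightarrow> u < n \<and> v < n"
    and no_claw: "adj c u \<Longrightarrow> adj c v \<Longrightarrow> adj c w \<Longrightarrow> u \<noteq> v \<Longrightarrow> u \<noteq> w \<Longrightarrow> v \<noteq> w \<Longrightarrow>
      adj u v \<or> adj u w \<or> adj v w"
begin

lemma adj_commute: "adj u v \<longleftrightarrow> adj v u"
  using adj_sym by blast

lemma capacity_sym: "capacity n adj a x b y u v = capacity n adj a x b y v u"
proof -
  have "forced n adj a x b y u v \<longleftrightarrow> forced n adj a x b y v u"
    unfolding forced_def by blast
  then show ?thesis
    by (simp add: capacity_def adj_commute[of u v])
qed

text \<open>The right-hand side is the supply \<open>D\<close> that the program gives to the
  source.\<close>

lemma capacity_out_bound: "(\<Sum>v<n. capacity n adj a x b y u v) < n * (n * n + 1) + 1"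
proof -
  have "(\<Sum>v<n. capacity n adj a x b y u v) \<le> (\<Sum>v<n. n * n + 1)"
    by (intro sum_mono) (auto simp: capacity_def)
  then show ?thesis by simp
qed

lemma card_crossing: "S \<subseteq> {..<n} \<Longrightarrow> card (crossing n adj S) \<le> n * n"
  using card_mono[of "{..<n} \<times> {..<n}" "crossing n adj S"]
  by (auto simp: crossing_def card_cartesian_product)

lemma cut_capacity_eq_card_crossing:
  assumes S: "S \<subseteq> {..<n}"
    and one: "\<And>u v. u \<in> S \<Longrightarrow> v \<in> {..<n} - S \<Longrightarrow> cap u v = of_bool (adj u v)"
  shows "cut_capacity n cap S = card (crossing n adj S)"
proof -
  have fin: "finite S"
    using S finite_subset by blast
  have "cut_capacity n cap S = (\<Sum>u\<in>S. \<Sum>v\<in>{..<n} - S. of_bool (adj u v))"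
    unfolding cut_capacity_def using one by (intro sum.cong) auto
  also have "\<dots> = (\<Sum>p\<in>S \<times> ({..<n} - S). of_bool (adj (fst p) (snd p)))"
    by (simp only: sum.cartesian_product split_def)
  also have "\<dots> = card ((S \<times> ({..<n} - S)) \<inter> {p. adj (fst p) (snd p)})"
    using fin by (simp add: of_bool_def sum.If_cases)
  also have "(S \<times> ({..<n} - S)) \<inter> {p. adj (fst p) (snd p)} = crossing n adj S"
    by (auto simp: crossing_def)
  finally show ?thesis .
qed

text \<open>Take a terminal on each side, and as \<open>x\<close> and \<open>y\<close> their
  partners across the cut. Then no crossing edge is forced, so the given cut costs exactly its size
  and bounds the minimum cut from above.\<close>

lemma min_cut_of_matching_side:
  assumes S: "matching_side n adj S"
  shows "\<exists>a<n. \<exists>x<n. \<exists>b<n. \<exists>y<n. \<exists>m\<le>card (crossing n adj S).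
    a \<noteq> b \<and> min_cut n (capacity n adj a x b y) a b m"
proof -
  have sub: "S \<subseteq> {..<n}"
    using S unfolding matching_side_def by blast
  obtain a b where ab: "a \<in> S" "b \<in> {..<n} - S"
    using S unfolding matching_side_def by blast
  have uniq: "v = v' \<and> u = u'" if "(u, v) \<in> crossing n adj S" "(u', v') \<in> crossing n adj S"
    "u = u' \<or> v = v'" for u v u' v'
    using S that unfolding matching_side_def by fastforce
  \<comment> \<open>If \<open>a\<close> has no cut edge, any vertex serves as
    \<open>x\<close>.\<close>
  have "\<exists>x<n. \<forall>v. (a, v) \<in> crossing n adj S \<longrightarrow> v = x"
  proof (cases "\<exists>v. (a, v) \<in> crossing n adj S")
    case True
    then obtain v where "(a, v) \<in> crossing n adj S" by blast
    moreover from this have "v < n"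
      using sub by (auto simp: crossing_def)
    ultimately show ?thesis
      using uniq by blast
  qed (use ab sub in auto)
  then obtain x where x: "x < n" "\<And>v. (a, v) \<in> crossing n adj S \<Longrightarrow> v = x"
    by blast
  have "\<exists>y<n. \<forall>u. (u, b) \<in> crossing n adj S \<longrightarrow> u = y"
  proof (cases "\<exists>u. (u, b) \<in> crossing n adj S")
    case True
    then obtain u where "(u, b) \<in> crossing n adj S" by blast
    moreover from this have "u < n"
      using sub by (auto simp: crossing_def)
    ultimately show ?thesis
      using uniq by blast
  qed (use ab sub in auto)
  then obtain y where y: "y < n" "\<And>u. (u, b) \<in> crossing n adj S \<Longrightarrow> u = y"
    by blast
  have "capacity n adj a x b y u v = of_bool (adj u v)" if uv: "u \<in> S" "v \<in> {..<n} - S" for u v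
  proof (cases "adj u v")
    case True
    then have cr: "(u, v) \<in> crossing n adj S"
      using uv by (simp add: crossing_def)
    \<comment> \<open>The third vertex \<open>w\<close> of a triangle lies on one side of the cut,
      so its edge to the end on the other side is a second cut edge at that end.\<close>
    have "\<not> (\<exists>w<n. adj u w \<and> adj v w)"
    proof
      assume "\<exists>w<n. adj u w \<and> adj v w"
      then obtain w where w: "w < n" "adj u w" "adj v w" by blast
      then show False
        using cr uv adj_irrefl adj_sym uniq[OF cr, of u w] uniq[OF cr, of w v]
        unfolding crossing_def by (cases "w \<in> S") auto
    qed
    moreover have "u = a \<Longrightarrow> v = x" "v = b \<Longrightarrow> u = y"
      using cr x y by blast+
    moreover have "v \<noteq> a" "u \<noteq> b"
      using uv ab by auto
    ultimately show ?thesis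
      using True unfolding capacity_def forced_def by auto
  qed (simp add: capacity_def)
  then have cap: "cut_capacity n (capacity n adj a x b y) S = card (crossing n adj S)"
    using sub by (intro cut_capacity_eq_card_crossing)
  let ?P = "\<lambda>m. \<exists>S\<subseteq>{..<n}. a \<in> S \<and> b \<notin> S \<and> cut_capacity n (capacity n adj a x b y) S = m"
  have "?P (card (crossing n adj S))"
    using cap ab sub by blast
  then have "?P (Least ?P)" "Least ?P \<le> card (crossing n adj S)"
    by (rule LeastI, rule Least_le)
  moreover have "min_cut n (capacity n adj a x b y) a b (Least ?P)"
    unfolding min_cut_def using \<open>?P (Least ?P)\<close> by (auto intro!: Least_le)
  moreover have "a < n" "b < n" "a \<noteq> b"
    using ab sub by auto
  ultimately show ?thesis
    using x(1) y(1) by blast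
qed

text \<open>
  By claw-freeness a vertex with two edges outside all triangles has no further neighbours, so
  moving a vertex with two such cut edges to the other side makes the cut smaller.
\<close>

lemma moving_decreases_cut:
  assumes S: "S \<subseteq> {..<n}" "c \<in> S"
    and v: "v \<notin> S" "v' \<notin> S" "v \<noteq> v'" "adj c v" "adj c v'"
    and nt: "\<And>w. adj c w \<Longrightarrow> \<not> adj v w" "\<And>w. adj c w \<Longrightarrow> \<not> adj v' w"
  shows "cut_capacity n (capacity n adj a x b y) (S - {c}) <
    cut_capacity n (capacity n adj a x b y) S"
proof -
  let ?cap = "capacity n adj a x b y"
  let ?A = "\<Sum>u\<in>S - {c}. \<Sum>z\<in>{..<n} - S. ?cap u z"
  have fin: "finite S"
    using S finite_subset by blast
  have "{..<n} - (S - {c}) = insert c ({..<n} - S)"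
    using S by auto
  then have "cut_capacity n ?cap (S - {c}) = (\<Sum>u\<in>S - {c}. ?cap u c) + ?A"
    unfolding cut_capacity_def using S by (simp add: sum.distrib)
  also have "(\<Sum>u\<in>S - {c}. ?cap u c) = 0"
  proof (rule sum.neutral, rule ballI)
    fix u assume "u \<in> S - {c}"
    then have "\<not> adj c u"
      using no_claw[of c v v' u] v nt by (metis DiffD1)
    then show "?cap u c = 0"
      using adj_sym by (auto simp: capacity_def)
  qed
  finally have 1: "cut_capacity n ?cap (S - {c}) = ?A"
    by simp
  have 2: "cut_capacity n ?cap S = (\<Sum>z\<in>{..<n} - S. ?cap c z) + ?A"
    unfolding cut_capacity_def using fin S by (simp add: sum.remove)
  have "0 < ?cap c v"
    using v by (simp add: capacity_def)
  also have "\<dots> \<le> (\<Sum>z\<in>{..<n} - S. ?cap c z)"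
    using v adj_less by (intro member_le_sum) auto
  finally show ?thesis
    using 1 2 by simp
qed

text \<open>Makes the moving argument available for vertices outside \<open>S\<close> as
  well.\<close>

lemma cut_capacity_complement:
  assumes "S \<subseteq> {..<n}"
  shows "cut_capacity n (capacity n adj a x b y) ({..<n} - S) =
    cut_capacity n (capacity n adj a x b y) S"
proof -
  have "{..<n} - ({..<n} - S) = S"
    using assms by auto
  then show ?thesis
    unfolding cut_capacity_def by (subst sum.swap) (simp add: capacity_sym)
qed

lemma matching_side_of_min_cut:
  assumes ab: "a < n" "b < n" "a \<noteq> b"
    and min: "min_cut n (capacity n adj a x b y) a b m" and m: "m < n * n + 1"
  shows "\<exists>S. matching_side n adj S \<and> card (crossing n adj S) = m"
proof -
  let ?cap = "capacity n adj a x b y"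
  obtain S where S: "S \<subseteq> {..<n}" "a \<in> S" "b \<notin> S" "cut_capacity n ?cap S = m"
    and le: "\<And>S'. S' \<subseteq> {..<n} \<Longrightarrow> a \<in> S' \<Longrightarrow> b \<notin> S' \<Longrightarrow> m \<le> cut_capacity n ?cap S'"
    using min unfolding min_cut_def by blast
  have fin: "finite S"
    using S finite_subset by blast
  have not_forced: "\<not> forced n adj a x b y u v"
    if uv: "u \<in> S" "v \<in> {..<n} - S" "adj u v" for u v
  proof
    assume "forced n adj a x b y u v"
    then have "n * n + 1 = ?cap u v"
      using uv by (simp add: capacity_def)
    also have "\<dots> \<le> (\<Sum>z\<in>{..<n} - S. ?cap u z)"
      using uv by (intro member_le_sum) auto
    also have "\<dots> \<le> cut_capacity n ?cap S"
      unfolding cut_capacity_def using uv fin by (intro member_le_sum) auto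
    finally show False
      using S m by simp
  qed
  have card: "card (crossing n adj S) = m"
    using S(1) not_forced unfolding S(4)[symmetric]
    by (intro cut_capacity_eq_card_crossing[symmetric]) (auto simp: capacity_def)
  have fst_unique: "v = v'"
    if "u \<in> S" "v \<in> {..<n} - S" "v' \<in> {..<n} - S" "adj u v" "adj u v'" for u v v'
  proof (rule ccontr)
    assume "v \<noteq> v'"
    have nf: "\<not> forced n adj a x b y u v" "\<not> forced n adj a x b y u v'"
      using that not_forced by blast+
    \<comment> \<open>Unforced edges at \<open>a\<close> all end at \<open>x\<close>, so there
      cannot be two of them. Hence \<open>S - {u}\<close> still separates the terminals.\<close>
    then have "u \<noteq> a"
      using \<open>v \<noteq> v'\<close> unfolding forced_def by blast
    have "cut_capacity n ?cap (S - {u}) < cut_capacity n ?cap S"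
      using that S(1) \<open>v \<noteq> v'\<close> nf adj_less unfolding forced_def
      by (intro moving_decreases_cut[of _ _ v v']) blast+
    then show False
      using le[of "S - {u}"] S \<open>u \<noteq> a\<close> by auto
  qed
  have snd_unique: "u = u'"
    if "u \<in> S" "u' \<in> S" "v \<in> {..<n} - S" "adj u v" "adj u' v" for u u' v
  proof (rule ccontr)
    assume "u \<noteq> u'"
    have nf: "\<not> forced n adj a x b y u v" "\<not> forced n adj a x b y u' v"
      using that not_forced by blast+
    then have "v \<noteq> b"
      using \<open>u \<noteq> u'\<close> unfolding forced_def by blast
    \<comment> \<open>The same argument with the sides exchanged: \<open>v\<close> leaves the
      complement of \<open>S\<close> and joins \<open>S\<close>.\<close>
    have "cut_capacity n ?cap ({..<n} - S - {v}) < cut_capacity n ?cap ({..<n} - S)"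
      using that S(1) \<open>u \<noteq> u'\<close> nf adj_less adj_sym unfolding forced_def
      by (intro moving_decreases_cut[of _ _ u u']) blast+
    also have "{..<n} - S - {v} = {..<n} - insert v S"
      by auto
    finally have "cut_capacity n ?cap (insert v S) < cut_capacity n ?cap S"
      using S(1) that by (simp add: cut_capacity_complement)
    then show False
      using le[of "insert v S"] S \<open>v \<noteq> b\<close> that by auto
  qed
  have "matching_side n adj S"
    unfolding matching_side_def crossing_def
    using S ab fst_unique snd_unique by fastforce
  then show ?thesis
    using card by blast
qed

end

section \<open>Translation between vertex sets and index sets\<close>

locale ordered_graph =
  fixes G :: "'a graph" and vs :: "'a list" and n :: nat and adj :: "nat \<Rightarrow> nat \<Rightarrow> bool"
  assumes simple: "simple_graph G"
    and vs: "distinct vs" "set vs = verts G" "length vs = n"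
    and adj_def: "\<And>i j. adj i j \<longleftrightarrow> i < n \<and> j < n \<and> {vs ! i, vs ! j} \<in> edges G"
begin

lemma nth_eq: "i < n \<Longrightarrow> j < n \<Longrightarrow> vs ! i = vs ! j \<longleftrightarrow> i = j"
  using vs nth_eq_iff_index_eq by blast

lemma no_loop: "{v, v} \<notin> edges G"
  using simple unfolding simple_graph_def by (auto simp: doubleton_eq_iff)

lemma claw_free_adjacency:
  assumes "claw_free G"
  shows "claw_free_adjacency n adj"
proof
  fix c u v w
  assume adj: "adj c u" "adj c v" "adj c w" and ne: "u \<noteq> v" "u \<noteq> w" "v \<noteq> w"
  show "adj u v \<or> adj u w \<or> adj v w"
  proof (rule ccontr)
    assume nadj: "\<not> (adj u v \<or> adj u w \<or> adj v w)"
    define g where "g = (\<lambda>i::nat. if i = 0 then c else if i = 1 then u else if i = 2 then v else w)"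
    have less: "c < n" "u < n" "v < n" "w < n"
      using adj by (auto simp: adj_def)
    have "c \<noteq> u" "c \<noteq> v" "c \<noteq> w"
      using adj no_loop by (auto simp: adj_def)
    then have "inj_on (\<lambda>i. vs ! g i) (verts claw)" "(\<lambda>i. vs ! g i) ` verts claw \<subseteq> verts G"
      using ne less vs by (auto simp: claw_def g_def nth_eq inj_on_def simp flip: vs(2))
    moreover have "\<forall>i\<in>verts claw. \<forall>j\<in>verts claw.
        {vs ! g i, vs ! g j} \<in> edges G \<longleftrightarrow> {i, j} \<in> edges claw"
      using adj nadj less no_loop
      by (auto simp: claw_def g_def adj_def doubleton_eq_iff insert_commute)
    ultimately have "contains_induced G claw"
      unfolding contains_induced_def by (intro exI[of _ "\<lambda>i. vs ! g i"]) blast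
    then show False
      using assms unfolding claw_free_def by simp
  qed
qed (use no_loop in \<open>auto simp: adj_def insert_commute\<close>)

definition cut_edges :: "nat set \<Rightarrow> 'a set set" where
  "cut_edges S = (\<lambda>(i, j). {vs ! i, vs ! j}) ` crossing n adj S"

text \<open>Equal doubletons could also match with their ends swapped, but one end has its index in
  \<open>S\<close> and the other does not.\<close>

lemma inj_on_crossing:
  assumes "S \<subseteq> {..<n}"
  shows "inj_on (\<lambda>(i, j). {vs ! i, vs ! j}) (crossing n adj S)"
  using assms by (auto simp: inj_on_def crossing_def doubleton_eq_iff nth_eq subset_iff)

lemma cut_edges_eq:
  assumes "S \<subseteq> {..<n}"
  shows "cut_edges S = {e \<in> edges G. \<exists>r\<in>(!) vs ` S. \<exists>b\<in>(!) vs ` ({..<n} - S). e = {r, b}}"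
  using assms unfolding cut_edges_def crossing_def by (auto simp: adj_def)

lemma verts_eq: "verts G = (!) vs ` {..<n}"
  using vs by (auto simp: in_set_conv_nth simp flip: vs(2))

lemma edge_cut_iff:
  "edge_cut G M \<longleftrightarrow> (\<exists>S\<subseteq>{..<n}. S \<noteq> {} \<and> S \<noteq> {..<n} \<and> M = cut_edges S)"
proof
  assume "edge_cut G M"
  then obtain R B where RB: "R \<noteq> {}" "B \<noteq> {}" "R \<union> B = verts G" "R \<inter> B = {}"
    and M: "M = {e \<in> edges G. \<exists>r\<in>R. \<exists>b\<in>B. e = {r, b}}"
    unfolding edge_cut_def by blast
  define S where "S = {i. i < n \<and> vs ! i \<in> R}"
  have R: "R = (!) vs ` S"
  proof -
    have "R \<subseteq> (!) vs ` {..<n}"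
      using RB(3) verts_eq by blast
    then show ?thesis
      by (auto simp: S_def)
  qed
  have B: "B = (!) vs ` ({..<n} - S)"
  proof -
    have "B = (!) vs ` {..<n} - R"
      using RB(3,4) verts_eq by blast
    then show ?thesis
      by (auto simp: S_def)
  qed
  have "S \<subseteq> {..<n}"
    by (auto simp: S_def)
  then have "M = cut_edges S"
    unfolding M R B by (simp add: cut_edges_eq)
  then show "\<exists>S\<subseteq>{..<n}. S \<noteq> {} \<and> S \<noteq> {..<n} \<and> M = cut_edges S"
    using RB(1,2) R B \<open>S \<subseteq> {..<n}\<close> by (intro exI[of _ S]) blast
next
  assume "\<exists>S\<subseteq>{..<n}. S \<noteq> {} \<and> S \<noteq> {..<n} \<and> M = cut_edges S"
  then obtain S where S: "S \<subseteq> {..<n}" "S \<noteq> {}" "S \<noteq> {..<n}" "M = cut_edges S"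
    by blast
  let ?R = "(!) vs ` S" and ?B = "(!) vs ` ({..<n} - S)"
  have "?R \<union> ?B = verts G"
    using S(1) verts_eq by blast
  moreover have "?R \<inter> ?B = {}"
    using S(1) by (auto simp: nth_eq subset_iff)
  moreover have "?R \<noteq> {}" "?B \<noteq> {}"
    using S(1-3) by auto
  moreover have "M = {e \<in> edges G. \<exists>r\<in>?R. \<exists>b\<in>?B. e = {r, b}}"
    unfolding S(4) cut_edges_eq[OF S(1)] ..
  ultimately show "edge_cut G M"
    unfolding edge_cut_def by (intro exI[of _ ?R] exI[of _ ?B] conjI)
qed

lemma matching_cut_edges:
  assumes S: "S \<subseteq> {..<n}"
  shows "matching (cut_edges S) \<longleftrightarrow> (\<forall>e\<in>crossing n adj S. \<forall>f\<in>crossing n adj S.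
    e \<noteq> f \<longrightarrow> fst e \<noteq> fst f \<and> snd e \<noteq> snd f)"
proof -
  let ?g = "\<lambda>(i, j). {vs ! i, vs ! j}"
  have "?g e \<noteq> ?g f \<longleftrightarrow> e \<noteq> f" if "e \<in> crossing n adj S" "f \<in> crossing n adj S" for e f
    using inj_on_crossing[OF S] that by (meson inj_on_eq_iff)
  moreover have "?g e \<inter> ?g f = {} \<longleftrightarrow> fst e \<noteq> fst f \<and> snd e \<noteq> snd f"
    if "e \<in> crossing n adj S" "f \<in> crossing n adj S" for e f
    using that S by (auto simp: crossing_def nth_eq subset_iff)
  ultimately show ?thesis
    unfolding matching_def cut_edges_def by auto
qed

lemma matching_cut_iff: "matching_cut G M \<longleftrightarrow> (\<exists>S. matching_side n adj S \<and> M = cut_edges S)"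
  unfolding matching_cut_def edge_cut_iff matching_side_def using matching_cut_edges by blast

lemma card_cut_edges: "matching_side n adj S \<Longrightarrow> card (cut_edges S) = card (crossing n adj S)"
  unfolding cut_edges_def matching_side_def by (simp add: card_image inj_on_crossing)

end

section \<open>The program\<close>

text \<open>
  Matrices are stored row by row; in place of a multiplication, the array \<open>p\<close> holds the
  multiples of \<open>n\<close>.
\<close>

abbreviation entry :: "name \<Rightarrow> name \<Rightarrow> name \<Rightarrow> aexp" where
  "entry m u v \<equiv> Read m (Plus (Read ''p'' (Var u)) (Var v))"

abbreviation write_entry :: "name \<Rightarrow> name \<Rightarrow> name \<Rightarrow> aexp \<Rightarrow> com" where
  "write_entry m u v \<equiv> Write m (Plus (Read ''p'' (Var u)) (Var v))"

abbreviation same :: "name \<Rightarrow> name \<Rightarrow> aexp" where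
  "same x y \<equiv> Eq (Var x) (Var y)"

abbreviation differ :: "name \<Rightarrow> name \<Rightarrow> aexp" where
  "differ x y \<equiv> Neg (same x y)"

text \<open>The root \<open>n\<close> of the word length is found by letting \<open>q\<close> run
  through the squares, adding \<open>2 * n + 1\<close> each time. \<open>c\<close> is the price
  \<open>n * n + 1\<close> of a forced edge, and \<open>d\<close>, built by repeated addition, is
  the supply \<open>n * c + 1\<close> of the source.\<close>

definition read_input :: com where
  "read_input =
    Seq (While (Minus (Var ''len'') (Var ''q''))
          (Seq (assign ''q'' (Plus (Var ''q'') (Plus (Plus (Var ''n'') (Var ''n'')) (Const 1))))
               (assign ''n'' (Plus (Var ''n'') (Const 1)))))
   (Seq (assign ''c'' (Plus (Var ''len'') (Const 1)))
   (Seq (assign ''d'' (Const 1))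
        (For ''u''
          (Seq (Write ''p'' (Plus (Var ''u'') (Const 1)) (Plus (Read ''p'' (Var ''u'')) (Var ''n'')))
               (assign ''d'' (Plus (Var ''d'') (Var ''c'')))))))"

text \<open>After the search, \<open>w\<close> is below \<open>n\<close> exactly if \<open>u\<close>
  and \<open>v\<close> have a common neighbour; \<open>Plus\<close> serves as disjunction.\<close>

definition init_entry :: com where
  "init_entry =
    Seq (Find ''w'' ''z'' (And (entry ''in'' ''u'' ''z'') (entry ''in'' ''v'' ''z'')))
        (If (entry ''in'' ''u'' ''v'')
          (If (Plus (Minus (Var ''n'') (Var ''w''))
              (Plus (And (same ''u'' ''a'') (differ ''v'' ''x''))
              (Plus (And (same ''v'' ''a'') (differ ''u'' ''x''))
              (Plus (And (same ''u'' ''b'') (differ ''v'' ''y''))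
                    (And (same ''v'' ''b'') (differ ''u'' ''y''))))))
            (write_entry ''r'' ''u'' ''v'' (Var ''c''))
            (write_entry ''r'' ''u'' ''v'' (Const 1)))
          (write_entry ''r'' ''u'' ''v'' (Const 0)))"

definition init_network :: com where
  "init_network =
    Seq (For ''u''
          (Seq (Write ''h'' (Var ''u'') (Const 0))
          (Seq (Write ''e'' (Var ''u'') (Const 0))
               (For ''v'' init_entry))))
        (Write ''e'' (Var ''a'') (Var ''d''))"

definition push_or_relabel :: com where
  "push_or_relabel =
    Seq (Find ''w'' ''v'' (And (entry ''r'' ''z'' ''v'')
          (Eq (Read ''h'' (Var ''z'')) (Plus (Read ''h'' (Var ''v'')) (Const 1)))))
        (If (Minus (Var ''n'') (Var ''w''))
          (Seq (write_entry ''r'' ''z'' ''w'' (Minus (entry ''r'' ''z'' ''w'') (Const 1)))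
          (Seq (write_entry ''r'' ''w'' ''z'' (Plus (entry ''r'' ''w'' ''z'') (Const 1)))
          (Seq (Write ''e'' (Var ''z'') (Minus (Read ''e'' (Var ''z'')) (Const 1)))
               (Write ''e'' (Var ''w'') (Plus (Read ''e'' (Var ''w'')) (Const 1))))))
          (Write ''h'' (Var ''z'') (Plus (Read ''h'' (Var ''z'')) (Const 1))))"

text \<open>The initial \<open>z = 0\<close> merely opens the loop. From then on \<open>z\<close> is
  an active vertex other than the sink and below height \<open>n\<close>, or it is \<open>n\<close>,
  which ends the loop.\<close>

definition max_flow :: com where
  "max_flow =
    Seq (assign ''z'' (Const 0))
        (While (Minus (Var ''n'') (Var ''z''))
          (Seq (Find ''z'' ''u'' (And (differ ''u'' ''b'') (And (Read ''e'' (Var ''u''))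
                 (Minus (Var ''n'') (Read ''h'' (Var ''u''))))))
               (If (Minus (Var ''n'') (Var ''z'')) push_or_relabel Skip)))"

text \<open>The first condition is affordability; the second accepts the value if nothing is stored
  yet or the stored value is larger.\<close>

definition update_result :: com where
  "update_result =
    If (And (Minus (Var ''c'') (Read ''e'' (Var ''b'')))
            (Plus (Neg (Var ''out'')) (Minus (Read ''out'' (Const 1)) (Read ''e'' (Var ''b'')))))
      (Seq (assign ''out'' (Const 1)) (Write ''out'' (Const 1) (Read ''e'' (Var ''b''))))
      Skip"

definition try_terminals :: com where
  "try_terminals =
    If (differ ''a'' ''b'') (Seq init_network (Seq max_flow update_result)) Skip"

definition min_matching_cut_program :: com where
  "min_matching_cut_program =
    Seq read_input (For ''a'' (For ''x'' (For ''b'' (For ''y'' try_terminals))))"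

section \<open>Program state and the arrays written by each piece\<close>

definition env :: "nat \<Rightarrow> (nat \<Rightarrow> nat \<Rightarrow> bool) \<Rightarrow> state \<Rightarrow> bool" where
  "env n adj s \<longleftrightarrow> s ''n'' 0 = n \<and> (\<forall>i<n. s ''p'' i = i * n) \<and>
     s ''c'' 0 = n * n + 1 \<and> s ''d'' 0 = n * (n * n + 1) + 1 \<and>
     (\<forall>i<n. \<forall>j<n. s ''in'' (i * n + j) = of_bool (adj i j))"

lemma env_cong:
  assumes "env n adj s" "\<And>y. y \<in> {''n'', ''p'', ''c'', ''d'', ''in''} \<Longrightarrow> s' y = s y"
  shows "env n adj s'"
  using assms by (simp add: env_def)

definition terminals :: "nat \<Rightarrow> nat \<Rightarrow> nat \<Rightarrow> nat \<Rightarrow> state \<Rightarrow> bool" where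
  "terminals a x b y s \<longleftrightarrow> s ''a'' 0 = a \<and> s ''x'' 0 = x \<and> s ''b'' 0 = b \<and> s ''y'' 0 = y"

lemma terminals_cong:
  assumes "terminals a x b y s" "\<And>y. y \<in> {''a'', ''x'', ''b'', ''y''} \<Longrightarrow> s' y = s y"
  shows "terminals a x b y s'"
  using assms by (simp add: terminals_def)

abbreviation matrix :: "nat \<Rightarrow> state \<Rightarrow> nat \<Rightarrow> nat \<Rightarrow> nat" where
  "matrix n s u v \<equiv> s ''r'' (u * n + v)"

lemma entry_index_eq:
  fixes n :: nat
  assumes "v < n" "v' < n"
  shows "u * n + v = u' * n + v' \<longleftrightarrow> u = u' \<and> v = v'"
proof -
  have "(u * n + v) div n = u" "(u' * n + v') div n = u'"
    using assms by auto
  then show ?thesis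
    by (metis add_left_cancel)
qed

lemma writes_init_entry [simp]: "writes init_entry = {''w'', ''z'', ''r''}"
  by (auto simp: init_entry_def)

lemma writes_push_or_relabel [simp]: "writes push_or_relabel = {''w'', ''v'', ''r'', ''e'', ''h''}"
  by (auto simp: push_or_relabel_def)

lemma writes_init_network [simp]:
  "writes init_network = {''u'', ''v'', ''w'', ''z'', ''r'', ''e'', ''h''}"
  by (auto simp: init_network_def)

lemma writes_max_flow [simp]:
  "writes max_flow = {''u'', ''v'', ''w'', ''z'', ''r'', ''e'', ''h''}"
  by (auto simp: max_flow_def)

lemma writes_try_terminals [simp]:
  "writes try_terminals = {''u'', ''v'', ''w'', ''z'', ''r'', ''e'', ''h'', ''out''}"
  by (auto simp: try_terminals_def update_result_def)

section \<open>Correctness of the pieces of the program\<close>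

lemma wp_init_entry:
  assumes env: "env n adj s" and trm: "terminals a x b y s" and k: "n \<le> k"
    and uv: "s ''u'' 0 = u" "s ''v'' 0 = v" "u < n" "v < n"
    and Q: "\<And>s'. s' ''r'' = (s ''r'')(u * n + v := capacity n adj a x b y u v) \<Longrightarrow>
      (\<And>y. y \<notin> {''w'', ''z'', ''r''} \<Longrightarrow> s' y = s y) \<Longrightarrow> Q s'"
  shows "wp k init_entry Q s"
  unfolding init_entry_def
proof (rule wp_Seq, rule wp_Find[where n = n and P = "\<lambda>i. adj u i \<and> adj v i"])
  fix i s'
  assume "i < n" "s' ''z'' 0 = i" "\<And>y. y \<noteq> ''z'' \<Longrightarrow> y \<noteq> ''w'' \<Longrightarrow> s' y = s y"
  then show "aval (And (entry ''in'' ''u'' ''z'') (entry ''in'' ''v'' ''z'')) s' \<noteq> 0 \<longleftrightarrow>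
      adj u i \<and> adj v i"
    using env uv by (simp add: env_def)
next
  fix s'
  assume fr: "\<And>y. y \<noteq> ''z'' \<Longrightarrow> y \<noteq> ''w'' \<Longrightarrow> s' y = s y"
    and w: "s' ''w'' 0 = n \<and> (\<forall>i<n. \<not> (adj u i \<and> adj v i)) \<or>
      s' ''w'' 0 < n \<and> adj u (s' ''w'' 0) \<and> adj v (s' ''w'' 0)"
  have tri: "s' ''w'' 0 < n \<longleftrightarrow> (\<exists>w<n. adj u w \<and> adj v w)"
    using w by auto
  have Q': "Q (s'(''r'' := (s' ''r'')(u * n + v := m)))" if "m = capacity n adj a x b y u v" for m
    using fr that by (intro Q) auto
  let ?forced = "Plus (Minus (Var ''n'') (Var ''w''))
    (Plus (And (same ''u'' ''a'') (differ ''v'' ''x''))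
    (Plus (And (same ''v'' ''a'') (differ ''u'' ''x''))
    (Plus (And (same ''u'' ''b'') (differ ''v'' ''y''))
          (And (same ''v'' ''b'') (differ ''u'' ''y'')))))"
  have vars: "s' ''u'' 0 = u" "s' ''v'' 0 = v" "s' ''p'' u = u * n" "s' ''n'' 0 = n"
    "s' ''c'' 0 = n * n + 1" "s' ''in'' (u * n + v) = of_bool (adj u v)"
    "s' ''a'' 0 = a" "s' ''x'' 0 = x" "s' ''b'' 0 = b" "s' ''y'' 0 = y"
    using env trm uv fr by (simp_all add: env_def terminals_def)
  have "aval ?forced s' \<noteq> 0 \<longleftrightarrow> forced n adj a x b y u v"
    unfolding forced_def tri[symmetric] by (simp add: vars) (meson not_le)
  moreover have "aval (entry ''in'' ''u'' ''v'') s' \<noteq> 0 \<longleftrightarrow> adj u v"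
    by (simp add: vars)
  ultimately have cap: "capacity n adj a x b y u v = (if aval (entry ''in'' ''u'' ''v'') s' \<noteq> 0
      then if aval ?forced s' \<noteq> 0 then n * n + 1 else 1 else 0)"
    unfolding capacity_def by presburger
  have write_cap: "wp k (write_entry ''r'' ''u'' ''v'' c) Q s'"
    if "aval c s' = capacity n adj a x b y u v" for c
    by (intro wp_Write) (simp add: that vars Q')
  show "wp k (If (entry ''in'' ''u'' ''v'')
          (If ?forced
            (write_entry ''r'' ''u'' ''v'' (Var ''c''))
            (write_entry ''r'' ''u'' ''v'' (Const 1)))
          (write_entry ''r'' ''u'' ''v'' (Const 0))) Q s'"
    by (intro wp_If write_cap) (simp_all only: cap if_True if_False not_False_eq_True simp_thms aval.simps vars)
qed (use env k in \<open>simp_all add: env_def\<close>)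

lemma wp_init_network:
  assumes env: "env n adj s" and trm: "terminals a x b y s" and k: "n \<le> k" and a: "a < n"
    and Q: "\<And>s'. (\<And>u v. u < n \<Longrightarrow> v < n \<Longrightarrow> matrix n s' u v = capacity n adj a x b y u v) \<Longrightarrow>
      (\<And>v. v < n \<Longrightarrow> s' ''e'' v = (if v = a then n * (n * n + 1) + 1 else 0)) \<Longrightarrow>
      (\<And>v. v < n \<Longrightarrow> s' ''h'' v = 0) \<Longrightarrow>
      (\<And>y. y \<notin> writes init_network \<Longrightarrow> s' y = s y) \<Longrightarrow> Q s'"
  shows "wp k init_network Q s"
proof -
  define I where "I = (\<lambda>i s'. (\<forall>u<i. \<forall>v<n. matrix n s' u v = capacity n adj a x b y u v) \<and>
    (\<forall>u<i. s' ''e'' u = 0 \<and> s' ''h'' u = 0))"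
  show ?thesis
    unfolding init_network_def
  proof (rule wp_Seq, rule wp_For[where n = n and I = I])
    fix i s'
    assume i: "i < n" "s' ''u'' 0 = i" and I: "I i s'"
      and fr: "\<And>y. y \<noteq> ''u'' \<Longrightarrow> y \<notin> writes (Seq (Write ''h'' (Var ''u'') (Const 0))
        (Seq (Write ''e'' (Var ''u'') (Const 0)) (For ''v'' init_entry))) \<Longrightarrow> s' y = s y"
    show "wp k (Seq (Write ''h'' (Var ''u'') (Const 0))
        (Seq (Write ''e'' (Var ''u'') (Const 0)) (For ''v'' init_entry)))
        (\<lambda>s''. I (Suc i) (update s'' ''u'' (Suc i))) s'"
    proof (intro wp_Seq wp_Write, rule wp_For[where n = n and
        I = "\<lambda>j s2. I i s2 \<and> s2 ''e'' i = 0 \<and> s2 ''h'' i = 0 \<and>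
          (\<forall>v<j. matrix n s2 i v = capacity n adj a x b y i v)"])
      fix j s2
      assume j: "j < n" "s2 ''v'' 0 = j"
        and J: "I i s2 \<and> s2 ''e'' i = 0 \<and> s2 ''h'' i = 0 \<and>
          (\<forall>v<j. matrix n s2 i v = capacity n adj a x b y i v)"
        and fr2: "\<And>y. y \<noteq> ''v'' \<Longrightarrow> y \<notin> writes init_entry \<Longrightarrow>
          s2 y = (s'(''h'' := (s' ''h'')(aval (Var ''u'') s' := aval (Const 0) s'),
            ''e'' := ((s'(''h'' := (s' ''h'')(aval (Var ''u'') s' := aval (Const 0) s'))) ''e'')
              (aval (Var ''u'') (s'(''h'' := (s' ''h'')(aval (Var ''u'') s' := aval (Const 0) s'))) :=
               aval (Const 0) (s'(''h'' := (s' ''h'')(aval (Var ''u'') s' := aval (Const 0) s')))))) y"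
      show "wp k init_entry (\<lambda>s3. I i (update s3 ''v'' (Suc j)) \<and>
          update s3 ''v'' (Suc j) ''e'' i = 0 \<and> update s3 ''v'' (Suc j) ''h'' i = 0 \<and>
          (\<forall>v<Suc j. matrix n (update s3 ''v'' (Suc j)) i v = capacity n adj a x b y i v)) s2"
      proof (rule wp_init_entry[where n = n and adj = adj and u = i and v = j])
        show "env n adj s2" "terminals a x b y s2"
          by (rule env_cong[OF env] terminals_cong[OF trm], use fr fr2 in fastforce)+
        show "s2 ''u'' 0 = i"
          using fr2 i by simp
      next
        fix s3
        assume "s3 ''r'' = (s2 ''r'')(i * n + j := capacity n adj a x b y i j)"
          "\<And>y. y \<notin> {''w'', ''z'', ''r''} \<Longrightarrow> s3 y = s2 y"
        then show "I i (update s3 ''v'' (Suc j)) \<and>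
          update s3 ''v'' (Suc j) ''e'' i = 0 \<and> update s3 ''v'' (Suc j) ''h'' i = 0 \<and>
          (\<forall>v<Suc j. matrix n (update s3 ''v'' (Suc j)) i v = capacity n adj a x b y i v)"
          using J i j by (auto simp: I_def entry_index_eq less_Suc_eq)
      qed (use i j k in simp_all)
    qed (use env i I fr k in \<open>auto simp: I_def env_def less_Suc_eq\<close>)
  next
    fix s'
    assume "I n s'" and fr: "\<And>y. y \<noteq> ''u'' \<Longrightarrow> y \<notin> writes (Seq (Write ''h'' (Var ''u'') (Const 0))
        (Seq (Write ''e'' (Var ''u'') (Const 0)) (For ''v'' init_entry))) \<Longrightarrow> s' y = s y"
    then show "wp k (Write ''e'' (Var ''a'') (Var ''d'')) Q s'"
      using env trm a by (intro wp_Write Q) (auto simp: I_def env_def terminals_def)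
  qed (use env k in \<open>simp_all add: env_def I_def\<close>)
qed

lemma (in network) wp_push_or_relabel:
  assumes n: "s0 ''n'' 0 = n" "n \<le> k" and p: "\<And>i. i < n \<Longrightarrow> s0 ''p'' i = i * n"
    and pre: "preflow (matrix n s0) (s0 ''e'') (s0 ''h'')"
    and z: "s0 ''z'' 0 = z" "z < n" "z \<noteq> t" "0 < s0 ''e'' z" "s0 ''h'' z < n"
  shows "wp k push_or_relabel (\<lambda>s'. preflow (matrix n s') (s' ''e'') (s' ''h'') \<and>
    potential (s' ''e'') (s' ''h'') < potential (s0 ''e'') (s0 ''h'')) s0"
  unfolding push_or_relabel_def
proof (rule wp_Seq, rule wp_Find[where n = n and
    P = "\<lambda>i. 0 < matrix n s0 z i \<and> s0 ''h'' z = s0 ''h'' i + 1"])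
  fix i s'
  assume "i < n" "s' ''v'' 0 = i" "\<And>y. y \<noteq> ''v'' \<Longrightarrow> y \<noteq> ''w'' \<Longrightarrow> s' y = s0 y"
  then show "aval (And (entry ''r'' ''z'' ''v'')
      (Eq (Read ''h'' (Var ''z'')) (Plus (Read ''h'' (Var ''v'')) (Const 1)))) s' \<noteq> 0 \<longleftrightarrow>
    0 < matrix n s0 z i \<and> s0 ''h'' z = s0 ''h'' i + 1"
    using z p by simp
next
  fix s'
  assume fr: "\<And>y. y \<noteq> ''v'' \<Longrightarrow> y \<noteq> ''w'' \<Longrightarrow> s' y = s0 y"
    and w: "s' ''w'' 0 = n \<and> (\<forall>i<n. \<not> (0 < matrix n s0 z i \<and> s0 ''h'' z = s0 ''h'' i + 1)) \<or>
      s' ''w'' 0 < n \<and> 0 < matrix n s0 z (s' ''w'' 0) \<and> s0 ''h'' z = s0 ''h'' (s' ''w'' 0) + 1"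
  let ?Q = "\<lambda>s'. preflow (matrix n s') (s' ''e'') (s' ''h'') \<and>
    potential (s' ''e'') (s' ''h'') < potential (s0 ''e'') (s0 ''h'')"
  define w where "w = s' ''w'' 0"
  have s': "s' ''r'' = s0 ''r''" "s' ''e'' = s0 ''e''" "s' ''h'' = s0 ''h''" "s' ''z'' 0 = z"
    "s' ''n'' 0 = n" "\<And>i. i < n \<Longrightarrow> s' ''p'' i = i * n" "s' ''w'' 0 = w"
    using fr z n p by (simp_all add: w_def)
  show "wp k (If (Minus (Var ''n'') (Var ''w''))
          (Seq (write_entry ''r'' ''z'' ''w'' (Minus (entry ''r'' ''z'' ''w'') (Const 1)))
          (Seq (write_entry ''r'' ''w'' ''z'' (Plus (entry ''r'' ''w'' ''z'') (Const 1)))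
          (Seq (Write ''e'' (Var ''z'') (Minus (Read ''e'' (Var ''z'')) (Const 1)))
               (Write ''e'' (Var ''w'') (Plus (Read ''e'' (Var ''w'')) (Const 1))))))
          (Write ''h'' (Var ''z'') (Plus (Read ''h'' (Var ''z'')) (Const 1)))) ?Q s'"
  proof (rule wp_If)
    assume "aval (Minus (Var ''n'') (Var ''w'')) s' \<noteq> 0"
    then have adm: "w < n" "0 < matrix n s0 z w" "s0 ''h'' z = s0 ''h'' w + 1"
      using w s' by auto
    then have "z \<noteq> w"
      by auto
    define s2 where "s2 = s'(''r'' := (s0 ''r'')(z * n + w := matrix n s0 z w - 1,
        w * n + z := matrix n s0 w z + 1),
      ''e'' := (s0 ''e'')(z := s0 ''e'' z - 1, w := s0 ''e'' w + 1))"
    have r2: "matrix n s2 i j = (if i = w \<and> j = z then matrix n s0 w z + 1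
        else if i = z \<and> j = w then matrix n s0 z w - 1 else matrix n s0 i j)"
      if "i < n" "j < n" for i j
      using that z(2) adm(1) by (simp add: s2_def entry_index_eq)
    have e2: "s2 ''e'' = (s0 ''e'')(z := s0 ''e'' z - 1, w := s0 ''e'' w + 1)"
      and h2: "s2 ''h'' = s0 ''h''"
      by (simp_all add: s2_def s')
    define Q where "Q = ?Q"
    have "Q s2"
      unfolding h2 Q_def
      by (intro conjI push[where r' = "matrix n s2",
            OF pre \<open>z < n\<close> \<open>w < n\<close> \<open>0 < s0 ''e'' z\<close> adm(2,3)])
        (use z(2) adm(1) \<open>z \<noteq> w\<close> in \<open>auto simp: r2 e2\<close>)
    moreover have "z * n + w \<noteq> w * n + z" "w * n + z \<noteq> z * n + w"
      using entry_index_eq z(2) adm(1) \<open>z \<noteq> w\<close> by blast+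
    ultimately have "wp k (Seq (write_entry ''r'' ''z'' ''w'' (Minus (entry ''r'' ''z'' ''w'') (Const 1)))
          (Seq (write_entry ''r'' ''w'' ''z'' (Plus (entry ''r'' ''w'' ''z'') (Const 1)))
          (Seq (Write ''e'' (Var ''z'') (Minus (Read ''e'' (Var ''z'')) (Const 1)))
               (Write ''e'' (Var ''w'') (Plus (Read ''e'' (Var ''w'')) (Const 1)))))) Q s'"
      using z(2) adm(1) \<open>z \<noteq> w\<close>
      by (intro wp_Seq[OF wp_Write_eq[where a = "Plus (Read ''p'' (Var ''z'')) (Var ''w'')"
              and i = "z * n + w" and v = "matrix n s0 z w - 1"]]
          wp_Seq[OF wp_Write_eq[where a = "Plus (Read ''p'' (Var ''w'')) (Var ''z'')"
              and i = "w * n + z" and v = "matrix n s0 w z + 1"]]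
          wp_Seq[OF wp_Write_eq[where a = "Var ''z''" and i = z and v = "s0 ''e'' z - 1"]]
          wp_Write_eq[where i = w and v = "s0 ''e'' w + 1"])
        (simp_all add: s2_def s')
    then show "wp k (Seq (write_entry ''r'' ''z'' ''w'' (Minus (entry ''r'' ''z'' ''w'') (Const 1)))
          (Seq (write_entry ''r'' ''w'' ''z'' (Plus (entry ''r'' ''w'' ''z'') (Const 1)))
          (Seq (Write ''e'' (Var ''z'') (Minus (Read ''e'' (Var ''z'')) (Const 1)))
               (Write ''e'' (Var ''w'') (Plus (Read ''e'' (Var ''w'')) (Const 1)))))) ?Q s'"
      unfolding Q_def .
  next
    assume "aval (Minus (Var ''n'') (Var ''w'')) s' = 0"
    then have "\<not> s' ''w'' 0 < n"
      using s'(5) by simp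
    then have no_adm: "\<not> (0 < matrix n s0 z i \<and> s0 ''h'' z = s0 ''h'' i + 1)" if "i < n" for i
      using w that by blast
    have "preflow (matrix n s0) (s0 ''e'') ((s0 ''h'')(z := s0 ''h'' z + 1)) \<and>
      potential (s0 ''e'') ((s0 ''h'')(z := s0 ''h'' z + 1)) < potential (s0 ''e'') (s0 ''h'')"
      using relabel[OF pre z(2-5) no_adm] by simp
    then show "wp k (Write ''h'' (Var ''z'') (Plus (Read ''h'' (Var ''z'')) (Const 1))) ?Q s'"
      by (intro wp_Write) (simp add: s')
  qed
qed (use n in simp_all)

lemma (in network) wp_max_flow:
  assumes n: "s0 ''n'' 0 = n" "n \<le> k" and p: "\<And>i. i < n \<Longrightarrow> s0 ''p'' i = i * n"
    and b: "s0 ''b'' 0 = t"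
    and pre: "preflow (matrix n s0) (s0 ''e'') (s0 ''h'')"
    and k: "potential (s0 ''e'') (s0 ''h'') < k"
  shows "wp k max_flow (\<lambda>s'. min_cut n cap s t (s' ''e'' t)) s0"
proof -
  \<comment> \<open>The last pass finds no active vertex and leaves the potential unchanged; the
    extra 1 counted while \<open>z\<close> is below \<open>n\<close> makes the variant drop there
    too.\<close>
  define J where "J = (\<lambda>j s'.
    preflow (matrix n s') (s' ''e'') (s' ''h'') \<and>
    j = potential (s' ''e'') (s' ''h'') + of_bool (s' ''z'' 0 < n) \<and>
    (s' ''z'' 0 < n \<or> s' ''z'' 0 = n \<and>
      (\<forall>u<n. u \<noteq> t \<longrightarrow> 0 < s' ''e'' u \<longrightarrow> n \<le> s' ''h'' u)) \<and>
    s' ''n'' = s0 ''n'' \<and> s' ''p'' = s0 ''p'' \<and> s' ''b'' = s0 ''b'')"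
  show ?thesis
    unfolding max_flow_def
  proof (intro wp_Seq wp_Write, rule wp_While[where I = J])
    show "J (potential (s0 ''e'') (s0 ''h'') + 1)
        (s0(''z'' := (s0 ''z'')(aval (Const 0) s0 := aval (Const 0) s0)))"
      using pre t by (simp add: J_def)
    show "potential (s0 ''e'') (s0 ''h'') + 1 \<le> k"
      using k by simp
  next
    fix j s1
    assume J: "J j s1" and "aval (Minus (Var ''n'') (Var ''z'')) s1 \<noteq> 0"
    then have s1: "s1 ''n'' 0 = n" "s1 ''b'' 0 = t" "\<And>i. i < n \<Longrightarrow> s1 ''p'' i = i * n"
      "s1 ''z'' 0 < n" "preflow (matrix n s1) (s1 ''e'') (s1 ''h'')"
      "j = potential (s1 ''e'') (s1 ''h'') + 1"
      using n p b by (auto simp: J_def)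
    show "wp k (Seq (Find ''z'' ''u'' (And (differ ''u'' ''b'') (And (Read ''e'' (Var ''u''))
                 (Minus (Var ''n'') (Read ''h'' (Var ''u''))))))
               (If (Minus (Var ''n'') (Var ''z'')) push_or_relabel Skip)) (\<lambda>s'. \<exists>i<j. J i s') s1"
    proof (rule wp_Seq, rule wp_Find[where n = n and
        P = "\<lambda>u. u \<noteq> t \<and> 0 < s1 ''e'' u \<and> s1 ''h'' u < n"])
      fix i s'
      assume "i < n" "s' ''u'' 0 = i" "\<And>y. y \<noteq> ''u'' \<Longrightarrow> y \<noteq> ''z'' \<Longrightarrow> s' y = s1 y"
      then show "aval (And (differ ''u'' ''b'') (And (Read ''e'' (Var ''u''))
          (Minus (Var ''n'') (Read ''h'' (Var ''u''))))) s' \<noteq> 0 \<longleftrightarrow>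
        i \<noteq> t \<and> 0 < s1 ''e'' i \<and> s1 ''h'' i < n"
        using s1 by (simp add: not_le)
    next
      fix s'
      assume fr: "\<And>y. y \<noteq> ''u'' \<Longrightarrow> y \<noteq> ''z'' \<Longrightarrow> s' y = s1 y"
        and z: "s' ''z'' 0 = n \<and> (\<forall>u<n. \<not> (u \<noteq> t \<and> 0 < s1 ''e'' u \<and> s1 ''h'' u < n)) \<or>
          s' ''z'' 0 < n \<and> s' ''z'' 0 \<noteq> t \<and> 0 < s1 ''e'' (s' ''z'' 0) \<and> s1 ''h'' (s' ''z'' 0) < n"
      have s': "s' ''r'' = s1 ''r''" "s' ''e'' = s1 ''e''" "s' ''h'' = s1 ''h''" 
        "s' ''n'' = s1 ''n''" "s' ''p'' = s1 ''p''" "s' ''b'' = s1 ''b''"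
        using fr by simp_all
      show "wp k (If (Minus (Var ''n'') (Var ''z'')) push_or_relabel Skip) (\<lambda>s'. \<exists>i<j. J i s') s'"
      proof (rule wp_If)
        assume "aval (Minus (Var ''n'') (Var ''z'')) s' \<noteq> 0"
        then have z': "s' ''z'' 0 < n" "s' ''z'' 0 \<noteq> t" "0 < s' ''e'' (s' ''z'' 0)"
          "s' ''h'' (s' ''z'' 0) < n"
          using z s1 s' by auto
        show "wp k push_or_relabel (\<lambda>s'. \<exists>i<j. J i s') s'"
        proof (rule wp_frame[OF wp_push_or_relabel[OF _ _ _ _ refl z']])
          fix s2
          assume "preflow (matrix n s2) (s2 ''e'') (s2 ''h'') \<and>
              potential (s2 ''e'') (s2 ''h'') < potential (s' ''e'') (s' ''h'')"
            and fr2: "\<And>y. y \<notin> writes push_or_relabel \<Longrightarrow> s2 y = s' y"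
          then show "\<exists>i<j. J i s2"
            using J z' s1(6) s'
            by (intro exI[of _ "potential (s2 ''e'') (s2 ''h'') + 1"]) (simp add: J_def)
        qed (use s1 s' n in simp_all)
      next
        assume "aval (Minus (Var ''n'') (Var ''z'')) s' = 0"
        then have z': "s' ''z'' 0 = n" "\<forall>u<n. \<not> (u \<noteq> t \<and> 0 < s1 ''e'' u \<and> s1 ''h'' u < n)"
          using z s1(1) s' by auto
        then have "\<forall>u<n. u \<noteq> t \<longrightarrow> 0 < s' ''e'' u \<longrightarrow> n \<le> s' ''h'' u"
          unfolding s' using not_le by blast
        then have "J (potential (s1 ''e'') (s1 ''h'')) s'"
          using J z'(1) by (simp add: J_def s')
        then show "wp k Skip (\<lambda>s'. \<exists>i<j. J i s') s'"
          using s1(6) by (intro wp_Skip) auto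
      qed
    qed (use n s1 in simp_all)
  next
    fix j s'
    assume J: "J j s'" "aval (Minus (Var ''n'') (Var ''z'')) s' = 0"
    then show "min_cut n cap s t (s' ''e'' t)"
      using n by (intro min_cut_of_final_preflow[of "matrix n s'" "s' ''e''" "s' ''h''"])
        (auto simp: J_def)
  qed
qed

text \<open>By \<open>min_cut_unique\<close> this set has at most one element; degenerate or
  unaffordable guesses contribute nothing.\<close>

definition cut_values :: "nat \<Rightarrow> (nat \<Rightarrow> nat \<Rightarrow> bool) \<Rightarrow> nat \<Rightarrow> nat \<Rightarrow> nat \<Rightarrow> nat \<Rightarrow> nat set" where
  "cut_values n adj a x b y =
     {m. a \<noteq> b \<and> m < n * n + 1 \<and> min_cut n (capacity n adj a x b y) a b m}"

definition best :: "nat set \<Rightarrow> state \<Rightarrow> bool" where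
  "best U s \<longleftrightarrow> s ''out'' 0 = 0 \<and> U = {} \<or>
     s ''out'' 0 = 1 \<and> s ''out'' 1 \<in> U \<and> (\<forall>m\<in>U. s ''out'' 1 \<le> m)"

lemma best_cong: "best U s \<Longrightarrow> s' ''out'' = s ''out'' \<Longrightarrow> best U s'"
  by (simp add: best_def)

lemma best_update [simp]: "x \<noteq> ''out'' \<Longrightarrow> best U (s(x := f)) \<longleftrightarrow> best U s"
  by (simp add: best_def)

lemma min_cut_unique: "min_cut n cap s t m \<Longrightarrow> min_cut n cap s t m' \<Longrightarrow> m = m'"
  unfolding min_cut_def by (meson le_antisym)

text \<open>An upper bound on the initial potential, and hence on the iterations of every loop.\<close>

definition loop_bound :: "nat \<Rightarrow> nat" where
  "loop_bound n = (n * (n * n + 1) + 2) * (n * n) + n + 1"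

lemma (in claw_free_adjacency) wp_try_terminals:
  assumes env: "env n adj s" and trm: "terminals a x b y s" and ab: "a < n" "b < n"
    and best: "best U s"
  shows "wp (loop_bound n) try_terminals (best (U \<union> cut_values n adj a x b y)) s"
  unfolding try_terminals_def
proof (rule wp_If)
  assume "aval (differ ''a'' ''b'') s = 0"
  then show "wp (loop_bound n) Skip (best (U \<union> cut_values n adj a x b y)) s"
    using best trm by (simp add: cut_values_def terminals_def)
next
  assume "aval (differ ''a'' ''b'') s \<noteq> 0"
  then have neq: "a \<noteq> b"
    using trm by (simp add: terminals_def split: if_splits)
  let ?cap = "capacity n adj a x b y" and ?D = "n * (n * n + 1) + 1"
  interpret network n ?cap a b ?D
    using ab neq capacity_sym capacity_out_bound by unfold_locales
  show "wp (loop_bound n) (Seq init_network (Seq max_flow update_result))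
      (best (U \<union> cut_values n adj a x b y)) s"
  proof (rule wp_Seq, rule wp_init_network[OF env trm], goal_cases)
    case 1
    show ?case by (simp add: loop_bound_def)
  next
    case 2
    show ?case by fact
  next
    case (3 s1)
    have pre: "preflow (matrix n s1) (s1 ''e'') (s1 ''h'')"
      and pot: "potential (s1 ''e'') (s1 ''h'') = (?D + 1) * (n * n)"
      using 3(1-3) by (intro preflow_init; simp)+
    have s1: "s1 ''n'' 0 = n" "\<And>i. i < n \<Longrightarrow> s1 ''p'' i = i * n" "s1 ''b'' 0 = b"
      "s1 ''c'' 0 = n * n + 1" "s1 ''out'' = s ''out''"
      using 3(4) env trm by (simp_all add: env_def terminals_def)
    show ?case
    proof (rule wp_Seq, rule wp_frame[OF wp_max_flow], goal_cases)
      case (7 s2)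
      define m where "m = s2 ''e'' b"
      have s2: "s2 ''b'' 0 = b" "s2 ''c'' 0 = n * n + 1" "s2 ''out'' = s ''out''"
        using 7(2) s1 by simp_all
      have "best U s2"
        using best s2(3) by (rule best_cong)
      have cv: "cut_values n adj a x b y = (if m < n * n + 1 then {m} else {})"
        using 7(1) neq unfolding cut_values_def m_def by (auto dest: min_cut_unique[OF 7(1)])
      show ?case
        unfolding update_result_def
      proof (rule wp_If)
        assume "aval (And (Minus (Var ''c'') (Read ''e'' (Var ''b'')))
            (Plus (Neg (Var ''out'')) (Minus (Read ''out'' (Const 1)) (Read ''e'' (Var ''b''))))) s2 \<noteq> 0"
        then have "m < n * n + 1" "s2 ''out'' 0 = 0 \<or> m < s2 ''out'' 1"
          using s2(1,2) by (auto simp: m_def split: if_splits)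
        then show "wp (loop_bound n)
            (Seq (assign ''out'' (Const 1)) (Write ''out'' (Const 1) (Read ''e'' (Var ''b''))))
            (best (U \<union> cut_values n adj a x b y)) s2"
          using \<open>best U s2\<close> s2(1) unfolding cv
          by (intro wp_Seq wp_Write) (auto simp: best_def m_def)
      next
        assume "aval (And (Minus (Var ''c'') (Read ''e'' (Var ''b'')))
            (Plus (Neg (Var ''out'')) (Minus (Read ''out'' (Const 1)) (Read ''e'' (Var ''b''))))) s2 = 0"
        then have "\<not> m < n * n + 1 \<or> s2 ''out'' 0 \<noteq> 0 \<and> s2 ''out'' 1 \<le> m"
          using s2(1,2) by (auto simp: m_def split: if_splits)
        then show "wp (loop_bound n) Skip (best (U \<union> cut_values n adj a x b y)) s2"
          using \<open>best U s2\<close> unfolding cv by (intro wp_Skip) (auto simp: best_def)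
      qed
    qed (use s1 pre pot in \<open>simp_all add: loop_bound_def\<close>)
  qed
qed

lemma (in claw_free_adjacency) wp_search:
  assumes env: "env n adj s" and "s ''out'' 0 = 0"
  shows "wp (loop_bound n) (For ''a'' (For ''x'' (For ''b'' (For ''y'' try_terminals))))
    (best (\<Union>a<n. \<Union>x<n. \<Union>b<n. \<Union>y<n. cut_values n adj a x b y)) s"
proof -
  let ?V = "cut_values n adj"
  \<comment> \<open>The values contributed by the completed iterations of each of the four nested
    loops. The invariant of a loop joins its own set with those of the enclosing loops.\<close>
  define A where "A = (\<lambda>i. \<Union>a<i. \<Union>x<n. \<Union>b<n. \<Union>y<n. ?V a x b y)"
  define X where "X = (\<lambda>a i. \<Union>x<i. \<Union>b<n. \<Union>y<n. ?V a x b y)"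
  define B where "B = (\<lambda>a x i. \<Union>b<i. \<Union>y<n. ?V a x b y)"
  define Y where "Y = (\<lambda>a x b i. \<Union>y<i. ?V a x b y)"
  have step: "A (Suc a) = A a \<union> X a n" "X a (Suc x) = X a x \<union> B a x n"
    "B a x (Suc b) = B a x b \<union> Y a x b n" "Y a x b (Suc y) = Y a x b y \<union> ?V a x b y"
    and zero: "A 0 = {}" "X a 0 = {}" "B a x 0 = {}" "Y a x b 0 = {}" for a x b y
    unfolding A_def X_def B_def Y_def by (simp_all add: lessThan_Suc Un_commute)
  have k: "n \<le> loop_bound n"
    by (simp add: loop_bound_def)
  have n: "s' ''n'' 0 = n" if "env n adj s'" for s'
    using that by (simp add: env_def)
  have "wp (loop_bound n) (For ''a'' (For ''x'' (For ''b'' (For ''y'' try_terminals)))) (best (A n)) s"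
  proof (rule wp_For[where n = n and I = "\<lambda>i. best (A i)"], goal_cases)
    case (7 a s1)
    have e1: "env n adj s1"
      by (rule env_cong[OF env], rule 7(4)) auto
    show ?case
    proof (rule wp_For[where n = n and I = "\<lambda>i. best (A a \<union> X a i)"], goal_cases)
      case (7 x s2)
      have e2: "env n adj s2"
        by (rule env_cong[OF e1], rule 7(4)) auto
      have a2: "s2 ''a'' 0 = a"
        using 7(4) \<open>s1 ''a'' 0 = a\<close> by simp
      show ?case
      proof (rule wp_For[where n = n and I = "\<lambda>i. best (A a \<union> X a x \<union> B a x i)"], goal_cases)
        case (7 b s3)
        have e3: "env n adj s3"
          by (rule env_cong[OF e2], rule 7(4)) auto
        have a3: "s3 ''a'' 0 = a" "s3 ''x'' 0 = x"
          using 7(4) a2 \<open>s2 ''x'' 0 = x\<close> by simp_all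
        show ?case
        proof (rule wp_For[where n = n and I = "\<lambda>i. best (A a \<union> X a x \<union> B a x b \<union> Y a x b i)"],
            goal_cases)
          case (7 y s4)
          have e4: "env n adj s4"
            by (rule env_cong[OF e3], rule 7(4)) auto
          have "terminals a x b y s4"
            using 7(3,4) a3 \<open>s3 ''b'' 0 = b\<close> by (simp add: terminals_def)
          from wp_try_terminals[OF e4 this \<open>a < n\<close> \<open>b < n\<close> 7(2)]
          show ?case
            by (rule wp_frame) (simp add: step Un_assoc)
        qed (use 7 k n[OF e3] in \<open>simp_all add: zero step Un_assoc\<close>)
      qed (use 7 k n[OF e2] in \<open>simp_all add: zero step Un_assoc\<close>)
    qed (use 7 k n[OF e1] in \<open>simp_all add: zero step Un_assoc\<close>)
  qed (use k n[OF env] assms(2) in \<open>simp_all add: zero best_def\<close>)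
  then show ?thesis
    unfolding A_def .
qed

lemma wp_read_input:
  assumes len: "s ''len'' 0 = n * n" and zero: "s ''n'' 0 = 0" "s ''q'' 0 = 0" "s ''p'' 0 = 0"
    and k: "n \<le> k"
    and input: "\<And>i j. i < n \<Longrightarrow> j < n \<Longrightarrow> s ''in'' (i * n + j) = of_bool (adj i j)"
  shows "wp k read_input (env n adj) s"
  unfolding read_input_def
proof (rule wp_Seq, rule wp_While[where i = n and I = "\<lambda>j s'. \<exists>m\<le>n. j = n - m \<and> s' ''n'' 0 = m \<and>
    s' ''q'' 0 = m * m \<and> (\<forall>y. y \<notin> {''n'', ''q''} \<longrightarrow> s' y = s y)"], goal_cases)
  case (3 j s')
  then obtain m where m: "m \<le> n" "j = n - m" "s' ''n'' 0 = m" "s' ''q'' 0 = m * m"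
    and fr: "\<And>y. y \<notin> {''n'', ''q''} \<Longrightarrow> s' y = s y"
    by blast
  have "m < n"
    using 3(2) m fr len by (cases "m = n") auto
  then show ?case
    using m(1-4) by (intro wp_Seq wp_Write exI[of _ "n - Suc m"] conjI exI[of _ "Suc m"]) (auto simp: fr)
next
  case (4 j s')
  then obtain m where m: "m \<le> n" "s' ''n'' 0 = m" "s' ''q'' 0 = m * m"
    and fr: "\<And>y. y \<notin> {''n'', ''q''} \<Longrightarrow> s' y = s y"
    by blast
  have "n * n \<le> m * m"
    using 4(2) m(3) fr len by simp
  then have "m = n"
    using m(1) power2_nat_le_eq_le[of n m] by (simp add: power2_eq_square)
  then have s': "s' ''n'' 0 = n" "s' ''len'' 0 = n * n" "s' ''p'' 0 = 0" "s' ''in'' = s ''in''"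
    using m fr len zero by simp_all
  show ?case
  proof (intro wp_Seq wp_Write, rule wp_For[where n = n and I = "\<lambda>i s2.
      (\<forall>j\<le>i. s2 ''p'' j = j * n) \<and> s2 ''d'' 0 = i * (n * n + 1) + 1"], goal_cases)
    case (7 i s2)
    have "s2 ''n'' 0 = n" "s2 ''c'' 0 = n * n + 1"
      using 7(4)[of "''n''"] 7(4)[of "''c''"] s' by simp_all
    then show ?case
      using 7(2,3) by (intro wp_Seq wp_Write) (auto simp: le_Suc_eq)
  next
    case (8 s2)
    have "s2 ''n'' 0 = n" "s2 ''c'' 0 = n * n + 1" "s2 ''in'' = s ''in''"
      using 8(2)[of "''n''"] 8(2)[of "''c''"] 8(2)[of "''in''"] s' by simp_all
    then show ?case
      using 8(1) input by (simp add: env_def)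
  qed (use s' k in auto)
qed (use assms in auto)

section \<open>Adjacency matrices as words, and the final assembly\<close>

lemma length_concat_square:
  "length (concat (map (\<lambda>u. map (f u) vs) us)) = length us * length vs"
  by (induction us) auto

lemma nth_concat_square:
  assumes "i < length us" "j < length vs"
  shows "concat (map (\<lambda>u. map (f u) vs) us) ! (i * length vs + j) = f (us ! i) (vs ! j)"
  using assms(1)
proof (induction us arbitrary: i)
  case (Cons u us)
  then show ?case
    using assms(2) by (cases i) (auto simp: nth_append add.assoc)
qed simp

theorem theorem8:
  "poly_time_solvable encodes_graph
     {G :: nat graph. simple_graph G \<and> claw_free G}
     minimum_matching_cut_answer"
proof -
  obtain p :: "nat poly" where p: "\<And>k. time_bound k min_matching_cut_program = poly p k"
    using time_bound_poly by blast
  define X :: "nat poly" where "X = [:0, 1:]"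
  define q where "q = pcompose p ((X * (X * X + 1) + 2) * (X * X) + X + 1)"
  have q: "poly q n = poly p (loop_bound n)" for n
    by (simp add: q_def poly_pcompose loop_bound_def X_def algebra_simps)
  have "\<exists>t s. exec min_matching_cut_program (initial_state w) t s \<and> t \<le> poly q (length w) \<and>
      minimum_matching_cut_answer G (result s)"
    if G: "simple_graph G" "claw_free G" and w: "encodes_graph w G" for G :: "nat graph" and w
  proof -
    obtain vs where vs: "distinct vs" "set vs = verts G"
      and w: "w = concat (map (\<lambda>u. map (\<lambda>v. {u, v} \<in> edges G) vs) vs)"
      using w unfolding encodes_graph_def by blast
    define n where "n = length vs"
    define adj where "adj = (\<lambda>i j. i < n \<and> j < n \<and> {vs ! i, vs ! j} \<in> edges G)"
    interpret ordered_graph G vs n adj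
      using G vs by unfold_locales (simp_all add: n_def adj_def)
    interpret claw_free_adjacency n adj
      using G(2) by (rule claw_free_adjacency)
    have len: "length w = n * n"
      unfolding w n_def by (rule length_concat_square)
    have nth: "w ! (i * n + j) = adj i j" if "i < n" "j < n" for i j
      using that unfolding w n_def by (subst nth_concat_square) (simp_all add: adj_def n_def)
    have less: "i * n + j < n * n" if "i < n" "j < n" for i j
    proof -
      have "i * n + j < Suc i * n"
        using that by simp
      also have "\<dots> \<le> n * n"
        using that by (intro mult_right_mono) auto
      finally show ?thesis .
    qed
    let ?s = "initial_state w" and ?k = "loop_bound n"
    let ?U = "\<Union>a<n. \<Union>x<n. \<Union>b<n. \<Union>y<n. cut_values n adj a x b y"
    have "wp ?k read_input (env n adj) ?s"
      by (rule wp_read_input) (simp_all add: initial_state_def len nth less loop_bound_def)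
    then have "wp ?k min_matching_cut_program (best ?U) ?s"
      unfolding min_matching_cut_program_def
    proof (rule wp_Seq[OF wp_frame])
      fix s'
      assume "env n adj s'" "\<And>y. y \<notin> writes read_input \<Longrightarrow> s' y = ?s y"
      then show "wp ?k (For ''a'' (For ''x'' (For ''b'' (For ''y'' try_terminals)))) (best ?U) s'"
        by (intro wp_search) (simp_all add: read_input_def initial_state_def)
    qed
    then obtain t s where exec: "exec min_matching_cut_program ?s t s" "t \<le> poly p ?k"
      and best: "best ?U s"
      unfolding wp_def p by blast
    \<comment> \<open>The bound is polynomial in the number \<open>n\<close> of vertices; the word
      has length \<open>n * n\<close>, which is at least \<open>n\<close>.\<close>
    have "t \<le> poly q n"
      using exec(2) by (simp add: q)
    also have "\<dots> \<le> poly q (length w)"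
      unfolding len by (rule poly_nat_mono) simp
    finally have t: "t \<le> poly q (length w)" .
    have sound: "\<exists>M. matching_cut G M \<and> card M = m" if m: "m \<in> ?U" for m
    proof -
      obtain a x b y where "a < n" "b < n" "m \<in> cut_values n adj a x b y"
        using m by auto
      then obtain S where "matching_side n adj S" "card (crossing n adj S) = m"
        unfolding cut_values_def using matching_side_of_min_cut by blast
      then show ?thesis
        using card_cut_edges matching_cut_iff by blast
    qed
    have complete: "\<exists>m\<in>?U. m \<le> card M" if M: "matching_cut G M" for M
    proof -
      obtain S where S: "matching_side n adj S" "M = cut_edges S"
        using M matching_cut_iff by blast
      obtain a x b y m where *: "a < n" "x < n" "b < n" "y < n" "m \<le> card M" "a \<noteq> b"
        "min_cut n (capacity n adj a x b y) a b m"
        using min_cut_of_matching_side[OF S(1)] card_cut_edges[OF S(1)] S(2) by auto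
      \<comment> \<open>This makes \<open>m\<close> affordable, so that it really is among the
        collected values.\<close>
      have "card M \<le> n * n"
        using card_crossing[of S] card_cut_edges[OF S(1)] S unfolding matching_side_def by simp
      then have "m \<in> cut_values n adj a x b y"
        using * by (simp add: cut_values_def)
      then show ?thesis
        using * by blast
    qed
    have "minimum_matching_cut_answer G (result s)"
    proof (cases "?U = {}")
      case True
      then have "result s = None"
        using best by (simp add: best_def result_def)
      then show ?thesis
        using True complete unfolding minimum_matching_cut_answer_def by auto
    next
      case False
      then have res: "result s = Some (s ''out'' 1)" "s ''out'' 1 \<in> ?U" "\<And>m. m \<in> ?U \<Longrightarrow> s ''out'' 1 \<le> m"
        using best by (auto simp: best_def result_def)
      obtain M where "matching_cut G M" "card M = s ''out'' 1"
        using sound[OF res(2)] by blast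
      moreover have "s ''out'' 1 \<le> card M'" if "matching_cut G M'" for M'
        using complete[OF that] res(3) le_trans by blast
      ultimately show ?thesis
        unfolding minimum_matching_cut_answer_def minimum_matching_cut_def by (auto simp: res(1))
    qed
    then show ?thesis
      using exec(1) t by blast
  qed
  then show ?thesis
    unfolding poly_time_solvable_def by blast
qed

end
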